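(* Let $t,k>0$, $\mu\in\mathcal{M}$, and $\alpha,\lambda_{k}\in\mathbb{R}$. Then $$\left\{k^{-1/\beta}X_{kt}^{\lambda_{k}\alpha}(k^{1/2}\,\cdot\,)\,\big|\,X_{0}^{\lambda_{k}\alpha}=k^{1/\beta}\mu(k^{-1/2}\,\cdot\,)\right\}\ \overset{\mathcal{L}}{=}\ \left\{X_{t}^{k^{1/2}\lambda_{k}\alpha}\,\big|\,X_{0}^{k^{1/2}\lambda_{k}\alpha}=\mu\right\}.$$ That is, the random measure $k^{-1/\beta}X_{kt}^{\lambda_{k}\alpha}(k^{1/2}\,\cdot\,)$, where the process $X^{\lambda_k\alpha}$ is started from the measure $k^{1/\beta}\mu(k^{-1/2}\,\cdot\,)$, has the same law as the random measure $X_{t}^{k^{1/2}\lambda_{k}\alpha}$, where the process $X^{k^{1/2}\lambda_k\alpha}$ is started from $\mu$.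
   Context: Notation. $\dot{\mathbb{R}}^{3}:=\mathbb{R}^{3}\setminus\{0\}$. The symbol $\overset{\mathcal{L}}{=}$ denotes equality in law. For a measure $\nu$ on $\dot{\mathbb{R}}^3$ and $c>0$, $\nu(c\,\cdot\,)$ denotes the measure $A\mapsto\nu(cA)$, $cA=\{cx:x\in A\}$; and $\langle\nu,f\rangle:=\int f\,d\nu$. Kernel. The free heat kernel is $p_{t}(x,y):=(4\pi t)^{-3/2}\exp(-|y-x|^{2}/4t)$, and $p_{t}(r):=(4\pi t)^{-3/2}\exp(-r^{2}/4t)$ for $r\ge0$. For $\alpha\in\mathbb{R}$, $t>0$, $x,y\in\dot{\mathbb{R}}^{3}$, the one-point-interaction heat kernel is $$p_{t}^{\alpha}(x,y):=p_{t}(x,y)+\frac{2t}{|x||y|}\,p_{t}(|x|+|y|)-\frac{8\pi\alpha t}{|x||y|}\int_{0}^{\infty}e^{-4\pi\alpha u}\,p_{t}(u+|x|+|y|)\,du .$$ Function and measure spaces. Let $\phi(x):=|x|^{-1}$ on $\dot{\mathbb{R}}^{3}$. Fix $\varrho\in(1,2)$. $\mathcal{H}$ is the Banach space of (classes of) measurable functions $\varphi$ on $\dot{\mathbb{R}}^{3}$ with $\|\varphi\|_{\mathcal{H}}:=\big(\int_{\dot{\mathbb{R}}^{3}}\phi(x)|\varphi(x)|^{\varrho}dx\big)^{1/\varrho}<\infty$. $\Phi$ is the set of all continuous functions $\varphi:\dot{\mathbb{R}}^{3}\to\mathbb{R}$ with $\varphi\in\mathcal{H}$ and $0\le\varphi\le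 C\phi$ for some constant $C=C_\varphi>0$, with the topology inherited from $\mathcal{H}$. $\mathcal{M}$ is the set of all Radon measures $\mu$ on $\dot{\mathbb{R}}^{3}$ with $\langle\mu,\varphi\rangle<\infty$ for all $\varphi\in\Phi$, endowed with the vague topology. Process (existence, uniqueness and characterization are known from Fleischmann and Mueller, 2004). Fix a branching rate $\eta>0$ and $0<\beta<1$. For each $\alpha\in\mathbb{R}$, $X^{\alpha}=(X^\alpha_t)_{t\ge 0}$ (super-Brownian motion in $\mathbb{R}^3$ with a single point source) is the $\mathcal{M}$-valued time-homogeneous Markov process whose laws $\mathbb{P}_\mu$ (started at deterministic $\mu\in\mathcal{M}$) satisfy, for all $\varphi\in\Phi$ and $t>0$, $$-\log\mathbb{E}_{\mu}\exp\langle X_{t}^{\alpha},-\varphi\rangle=\langle\mu,v(t,\cdot)\rangle,$$ where $v$ is the unique non-negative $\Phi$-valued solution of $$v(t,x)=\int_{\dot{\mathbb{R}}^{3}}p_{t}^{\alpha}(x,y)\,\varphi(y)\,dy-\eta\int_{0}^{t}ds\int_{\dot{\mathbb{R}}^{3}}dy\ p_{t-s}^{\alpha}(x,y)\,v^{1+\beta}(s,y),\qquad t>0,\ x\in\dot{\mathbb{R}}^{3},$$ (the integral form of $\partial_t v=\Delta^{(\alpha)}v-\eta v^{1+\beta}$ with $v(0+,\cdot)=\varphi$). The parameters $\eta,\beta,\varrho$ are the same for all processes occurring in the statement. *)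

theory Defs
  imports "HOL-Probability.Probability"
begin

abbreviation punctured :: "(real^3) set"
  where "punctured \<equiv> - {0}"

text \<open>Functions on the punctured space are total functions on \<^typ>\<open>real^3\<close> whose value at
  the origin never matters; measures on the punctured space have it as their actual space.\<close>

definition punctured_borel :: "(real^3) measure"
  where "punctured_borel = restrict_space borel punctured"

definition heat :: "real \<Rightarrow> real \<Rightarrow> real"
  where "heat t r = (4 * pi * t) powr (- 3/2) * exp (- (r^2 / (4 * t)))"

definition point_heat_kernel :: "real \<Rightarrow> real \<Rightarrow> real^3 \<Rightarrow> real^3 \<Rightarrow> real"
  where "point_heat_kernel \<alpha> t x y =
    heat t (norm (y - x))
    + 2 * t / (norm x * norm y) * heat t (norm x + norm y)
    - 8 * pi * \<alpha> * t / (norm x * norm y) *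
        (LINT u:{0..}|lborel. exp (- (4 * pi * \<alpha> * u)) * heat t (u + norm x + norm y))"

definition weighted_Lp :: "real \<Rightarrow> (real^3 \<Rightarrow> real) set"
  where "weighted_Lp \<rho> = {f. f \<in> borel_measurable punctured_borel \<and>
    (\<integral>\<^sup>+x\<in>punctured. ennreal (1 / norm x * \<bar>f x\<bar> powr \<rho>) \<partial>lborel) < \<infinity>}"

definition test_fun :: "real \<Rightarrow> (real^3 \<Rightarrow> real) set"
  where "test_fun \<rho> = {f. continuous_on punctured f \<and> f \<in> weighted_Lp \<rho> \<and>
    (\<exists>C>0. \<forall>x\<in>punctured. 0 \<le> f x \<and> f x \<le> C * (1 / norm x))}"

definition radon_measure :: "(real^3) measure \<Rightarrow> bool"
  where "radon_measure \<mu> \<longleftrightarrow>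
    sets \<mu> = sets punctured_borel \<and>
    (\<forall>K. compact K \<and> K \<subseteq> punctured \<longrightarrow> emeasure \<mu> K < \<infinity>) \<and>
    (\<forall>A\<in>sets \<mu>. emeasure \<mu> A = (SUP K\<in>{K. compact K \<and> K \<subseteq> A}. emeasure \<mu> K))"

definition state_set :: "real \<Rightarrow> (real^3) measure set"
  where "state_set \<rho> = {\<mu>. radon_measure \<mu> \<and>
    (\<forall>f\<in>test_fun \<rho>. (\<integral>\<^sup>+x. ennreal (f x) \<partial>\<mu>) < \<infinity>)}"

definition pairing :: "(real^3) measure \<Rightarrow> (real^3 \<Rightarrow> real) \<Rightarrow> real"
  where "pairing \<mu> f = (LINT x|\<mu>. f x)"

definition compact_support_fun :: "(real^3 \<Rightarrow> real) set"
  where "compact_support_fun = {f. continuous_on punctured f \<and>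
    (\<exists>K. compact K \<and> K \<subseteq> punctured \<and> (\<forall>x\<in>punctured - K. f x = 0))}"

definition vague_topology :: "real \<Rightarrow> (real^3) measure topology"
  where "vague_topology \<rho> = topology_generated_by
    {{\<mu>\<in>state_set \<rho>. pairing \<mu> f \<in> U} | f U. f \<in> compact_support_fun \<and> open U}"

definition state_space :: "real \<Rightarrow> (real^3) measure measure"
  where "state_space \<rho> = sigma (state_set \<rho>) {U. openin (vague_topology \<rho>) U}"

lemma topspace_vague_topology: "topspace (vague_topology \<rho>) = state_set \<rho>"
proof -
  have "(\<lambda>_. 0) \<in> compact_support_fun"
    by (auto simp: compact_support_fun_def)
  then have "\<exists>f U. state_set \<rho> = {\<mu>\<in>state_set \<rho>. pairing \<mu> f \<in> U} \<and>
      f \<in> compact_support_fun \<and> open U"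
    by (intro exI[of _ "\<lambda>_. 0"] exI[of _ UNIV]) auto
  then show ?thesis
    unfolding vague_topology_def topology_generated_by_topspace by blast
qed

lemma space_state_space: "space (state_space \<rho>) = state_set \<rho>"
  and sets_state_space:
    "sets (state_space \<rho>) = sigma_sets (state_set \<rho>) {U. openin (vague_topology \<rho>) U}"
proof -
  have "{U. openin (vague_topology \<rho>) U} \<subseteq> Pow (state_set \<rho>)"
    using openin_subset topspace_vague_topology by blast
  then show "space (state_space \<rho>) = state_set \<rho>"
    and "sets (state_space \<rho>) = sigma_sets (state_set \<rho>) {U. openin (vague_topology \<rho>) U}"
    by (simp_all add: state_space_def)
qed

text \<open>Integrability is part of being a solution, since the integrals below default to \<open>0\<close>
  otherwise; joint measurability in \<open>(s, y)\<close> of the integrand is included in it.\<close>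

definition mild_solution ::
    "real \<Rightarrow> real \<Rightarrow> real \<Rightarrow> real \<Rightarrow> (real^3 \<Rightarrow> real) \<Rightarrow> (real \<Rightarrow> real^3 \<Rightarrow> real) \<Rightarrow> bool"
  where "mild_solution \<eta> \<beta> \<rho> \<alpha> \<phi> v \<longleftrightarrow>
    (\<forall>t>0. v t \<in> test_fun \<rho>) \<and>
    (\<forall>t>0. \<forall>x\<in>punctured.
      set_integrable lborel punctured (\<lambda>y. point_heat_kernel \<alpha> t x y * \<phi> y) \<and>
      set_integrable (lborel \<Otimes>\<^sub>M lborel) ({0<..<t} \<times> punctured)
        (\<lambda>(s, y). point_heat_kernel \<alpha> (t - s) x y * v s y powr (1 + \<beta>)) \<and>
      v t x = (LINT y:punctured|lborel. point_heat_kernel \<alpha> t x y * \<phi> y)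
        - \<eta> * (LINT s:{0<..<t}|lborel. LINT y:punctured|lborel.
            point_heat_kernel \<alpha> (t - s) x y * v s y powr (1 + \<beta>)))"

definition unique_mild_solution ::
    "real \<Rightarrow> real \<Rightarrow> real \<Rightarrow> real \<Rightarrow> (real^3 \<Rightarrow> real) \<Rightarrow> (real \<Rightarrow> real^3 \<Rightarrow> real) \<Rightarrow> bool"
  where "unique_mild_solution \<eta> \<beta> \<rho> \<alpha> \<phi> v \<longleftrightarrow>
    mild_solution \<eta> \<beta> \<rho> \<alpha> \<phi> v \<and>
    (\<forall>w. mild_solution \<eta> \<beta> \<rho> \<alpha> \<phi> w \<longrightarrow> (\<forall>t>0. \<forall>x\<in>punctured. w t x = v t x))"

text \<open>\<open>P m\<close> is the law started at \<open>m\<close>; \<open>past\<close> is the natural filtration. The fourth condition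
  of \<open>markov_family\<close> says that the transition kernels are measurable probability kernels.\<close>

definition past :: "'m measure \<Rightarrow> 'w measure \<Rightarrow> (real \<Rightarrow> 'w \<Rightarrow> 'm) \<Rightarrow> real \<Rightarrow> 'w measure"
  where "past S P X s =
    sigma (space P) (\<Union>r\<in>{0..s}. {X r -` B \<inter> space P | B. B \<in> sets S})"

definition markov_family ::
    "'m measure \<Rightarrow> ('m \<Rightarrow> 'w measure) \<Rightarrow> (real \<Rightarrow> 'w \<Rightarrow> 'm) \<Rightarrow> bool"
  where "markov_family S P X \<longleftrightarrow>
    (\<forall>m\<in>space S. prob_space (P m)) \<and>
    (\<forall>m\<in>space S. \<forall>t\<ge>0. X t \<in> measurable (P m) S) \<and>
    (\<forall>m\<in>space S. AE \<omega> in P m. X 0 \<omega> = m) \<and>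
    (\<forall>t\<ge>0. (\<lambda>m. distr (P m) S (X t)) \<in> measurable S (prob_algebra S)) \<and>
    (\<forall>m\<in>space S. \<forall>s\<ge>0. \<forall>t\<ge>0. \<forall>B\<in>sets S.
      AE \<omega> in P m. real_cond_exp (P m) (past S (P m) X s) (\<lambda>\<omega>. indicator B (X (s + t) \<omega>)) \<omega>
        = measure (distr (P (X s \<omega>)) S (X t)) B)"

text \<open>Existence and uniqueness for the log-Laplace equation belong to the characterization of the
  process: \<open>v\<close> is the unique solution with initial datum \<open>\<phi>\<close>, and does not depend on the
  starting measure.\<close>

definition point_source_super_bm ::
    "real \<Rightarrow> real \<Rightarrow> real \<Rightarrow> real \<Rightarrow> ((real^3) measure \<Rightarrow> 'w measure) \<Rightarrow>
      (real \<Rightarrow> 'w \<Rightarrow> (real^3) measure) \<Rightarrow> bool"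
  where "point_source_super_bm \<eta> \<beta> \<rho> \<alpha> P X \<longleftrightarrow>
    markov_family (state_space \<rho>) P X \<and>
    (\<forall>\<phi>\<in>test_fun \<rho>. \<exists>v. unique_mild_solution \<eta> \<beta> \<rho> \<alpha> \<phi> v \<and>
      (\<forall>\<mu>\<in>state_set \<rho>. \<forall>t>0.
        - ln (LINT \<omega>|P \<mu>. exp (pairing (X t \<omega>) (\<lambda>x. - \<phi> x))) = pairing \<mu> (v t)))"

text \<open>\<open>dilate c \<nu>\<close> is the measure \<open>A \<mapsto> \<nu>(cA)\<close>, hence the image of \<open>\<nu>\<close> under division by \<open>c\<close>.\<close>

definition dilate :: "real \<Rightarrow> (real^3) measure \<Rightarrow> (real^3) measure"
  where "dilate c \<nu> = distr \<nu> punctured_borel (\<lambda>x. x /\<^sub>R c)"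

lemma emeasure_dilate:
  assumes "c > 0" "sets \<nu> = sets punctured_borel" "A \<in> sets punctured_borel"
  shows "emeasure (dilate c \<nu>) A = emeasure \<nu> ((\<lambda>x. c *\<^sub>R x) ` A)"
proof -
  have sp: "space \<nu> = punctured"
    using sets_eq_imp_space_eq[OF assms(2)] by (simp add: punctured_borel_def space_restrict_space)
  have m: "(\<lambda>x. x /\<^sub>R c) \<in> measurable \<nu> punctured_borel"
    unfolding measurable_cong_sets[OF assms(2) refl] punctured_borel_def
    using assms(1) by (intro measurable_restrict_space3) auto
  have "A \<subseteq> punctured"
    using sets.sets_into_space[OF assms(3)] by (simp add: punctured_borel_def space_restrict_space)
  then have "(\<lambda>x. x /\<^sub>R c) -` A \<inter> space \<nu> = (\<lambda>x. c *\<^sub>R x) ` A"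
    using assms(1) by (force simp: sp image_iff)
  then show ?thesis
    by (simp add: dilate_def emeasure_distr[OF m assms(3)])
qed

definition equal_in_law ::
    "'m measure \<Rightarrow> 'a measure \<Rightarrow> ('a \<Rightarrow> 'm) \<Rightarrow> 'b measure \<Rightarrow> ('b \<Rightarrow> 'm) \<Rightarrow> bool"
  where "equal_in_law S P Y Q Z \<longleftrightarrow>
    Y \<in> measurable P S \<and> Z \<in> measurable Q S \<and> distr P S Y = distr Q S Z"

end

theory Submission
  imports Defs
begin

text \<open>Substituting \<open>y \<mapsto> \<surd>k y\<close> and \<open>s \<mapsto> k s\<close> in the mild equation and using the parabolic scaling of
  the kernel, \<open>w(t, x) = k\<^bsup>1/\<beta>\<^esup> v(k t, \<surd>k x)\<close> solves the equation with parameter \<open>\<surd>k \<alpha>\<close> and datum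
  \<open>\<phi>\<close> whenever \<open>v\<close> solves the one with parameter \<open>\<alpha>\<close> and datum \<open>k\<^bsup>-1/\<beta>\<^esup> \<phi>(\<sqdot>/\<surd>k)\<close>. By uniqueness of
  mild solutions the two random measures have the same Laplace functional.

  Only nonnegative compactly supported test functions are needed to recover the law. Every such
  function is the increasing limit of maxima of cones with rational data, so
  countably many half-spaces \<open>{\<mu>. \<langle>\<mu>, f\<rangle> < a}\<close> generate the vague Borel sets. Finite intersections
  of half-spaces form a \<open>\<pi>\<close>-system, and their probabilities are obtained from the Laplace functional
  by approximating the indicator of \<open>exp (-\<langle>\<mu>, f\<rangle>) > exp (-a)\<close> by polynomials in
  \<open>exp (-\<langle>\<mu>, f\<rangle>)\<close>, one half-space at a time.\<close>

subsection \<open>Dilations and Lebesgue measure\<close>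

lemma nn_integral_lborel_scaleR:
  fixes f :: "'a::euclidean_space \<Rightarrow> ennreal"
  assumes "c > 0" "f \<in> borel_measurable borel"
  shows "(\<integral>\<^sup>+x. f x \<partial>lborel) = ennreal (c ^ DIM('a)) * (\<integral>\<^sup>+x. f (c *\<^sub>R x) \<partial>lborel)"
  using assms
  by (subst lborel_affine[of c 0])
    (simp_all add: nn_integral_density nn_integral_distr nn_integral_cmult)

lemma integrable_lborel_scaleR:
  fixes f :: "'a::euclidean_space \<Rightarrow> real"
  assumes "c > 0" "integrable lborel f"
  shows "integrable lborel (\<lambda>x. f (c *\<^sub>R x))"
proof -
  have [measurable]: "f \<in> borel_measurable borel"
    using borel_measurable_integrable[OF assms(2)] by simp
  have "ennreal (c ^ DIM('a)) * (\<integral>\<^sup>+x. ennreal (norm (f (c *\<^sub>R x))) \<partial>lborel) < \<infinity>"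
    using assms nn_integral_lborel_scaleR[of c "\<lambda>x. ennreal (norm (f x))"]
    by (simp add: integrable_iff_bounded)
  then show ?thesis
    using assms(1) by (auto simp: integrable_iff_bounded ennreal_mult_less_top)
qed

lemma integrable_lborel_scaleR_iff:
  fixes f :: "'a::euclidean_space \<Rightarrow> real"
  assumes "c > 0"
  shows "integrable lborel (\<lambda>x. f (c *\<^sub>R x)) \<longleftrightarrow> integrable lborel f"
  using assms integrable_lborel_scaleR[of c f]
    integrable_lborel_scaleR[of "1 / c" "\<lambda>x. f (c *\<^sub>R x)"] by auto

lemma integral_lborel_scaleR:
  fixes f :: "'a::euclidean_space \<Rightarrow> real"
  assumes "c > 0"
  shows "(LINT x|lborel. f x) = c ^ DIM('a) * (LINT x|lborel. f (c *\<^sub>R x))"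
proof (cases "integrable lborel f")
  case True
  have [measurable]: "f \<in> borel_measurable borel"
    using True by auto
  show ?thesis
    using assms integrable_lborel_scaleR[OF assms True]
    by (subst lborel_affine[of c 0]) (simp_all add: integral_density integral_distr)
next
  \<comment> \<open>The dilated function is then not integrable either, so both integrals have the
    default value 0.\<close>
  case False
  then show ?thesis
    using assms by (simp add: integrable_lborel_scaleR_iff not_integrable_integral_eq)
qed

text \<open>Tonelli reduces this to two one-variable substitutions. The two factors are separate
  because time will be dilated by \<open>k\<close> and space by \<open>sqrt k\<close>.\<close>

lemma integrable_lborel_pair_scaleR:
  fixes f :: "'a::euclidean_space \<times> 'b::euclidean_space \<Rightarrow> real"
  assumes "a > 0" "b > 0" "integrable (lborel \<Otimes>\<^sub>M lborel) f"
  shows "integrable (lborel \<Otimes>\<^sub>M lborel) (\<lambda>(x, y). f (a *\<^sub>R x, b *\<^sub>R y))"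
proof -
  have [measurable]: "f \<in> borel_measurable (borel \<Otimes>\<^sub>M borel)"
    using borel_measurable_integrable[OF assms(3)] by (simp cong: measurable_cong_sets)
  have "(\<integral>\<^sup>+p. ennreal (norm (f p)) \<partial>(lborel \<Otimes>\<^sub>M lborel))
      = (\<integral>\<^sup>+x. \<integral>\<^sup>+y. ennreal (norm (f (x, y))) \<partial>lborel \<partial>lborel)"
    by (rule lborel.nn_integral_fst[symmetric]) (simp cong: measurable_cong_sets)
  also have "\<dots> = ennreal (a ^ DIM('a)) *
      (\<integral>\<^sup>+x. \<integral>\<^sup>+y. ennreal (norm (f (a *\<^sub>R x, y))) \<partial>lborel \<partial>lborel)"
    by (rule nn_integral_lborel_scaleR[OF assms(1)]) measurable
  also have "\<dots> = ennreal (a ^ DIM('a)) *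
      (\<integral>\<^sup>+x. ennreal (b ^ DIM('b)) *
        (\<integral>\<^sup>+y. ennreal (norm (f (a *\<^sub>R x, b *\<^sub>R y))) \<partial>lborel) \<partial>lborel)"
    by (subst nn_integral_lborel_scaleR[OF assms(2)]) measurable
  also have "\<dots> = ennreal (a ^ DIM('a)) * (ennreal (b ^ DIM('b)) *
      (\<integral>\<^sup>+x. \<integral>\<^sup>+y. ennreal (norm (f (a *\<^sub>R x, b *\<^sub>R y))) \<partial>lborel \<partial>lborel))"
    by (subst nn_integral_cmult) measurable
  also have "(\<integral>\<^sup>+x. \<integral>\<^sup>+y. ennreal (norm (f (a *\<^sub>R x, b *\<^sub>R y))) \<partial>lborel \<partial>lborel)
      = (\<integral>\<^sup>+p. ennreal (norm (case p of (x, y) \<Rightarrow> f (a *\<^sub>R x, b *\<^sub>R y))) \<partial>(lborel \<Otimes>\<^sub>M lborel))"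
    by (subst lborel.nn_integral_fst[symmetric]) (simp_all cong: measurable_cong_sets)
  finally have "\<dots> < \<infinity>"
    using assms by (auto simp: integrable_iff_bounded ennreal_mult_less_top)
  then show ?thesis
    by (auto simp: integrable_iff_bounded cong: measurable_cong_sets)
qed

lemma indicator_punctured_scaleR:
  assumes "(c::real) > 0"
  shows "indicator punctured (c *\<^sub>R x) = (indicator punctured x :: real)"
  using assms by (simp add: indicator_def)

lemma set_integrable_punctured_scaleR:
  fixes f :: "real^3 \<Rightarrow> real"
  assumes "c > 0" "set_integrable lborel punctured f"
  shows "set_integrable lborel punctured (\<lambda>y. f (c *\<^sub>R y))"
  using integrable_lborel_scaleR[OF assms(1) assms(2)[unfolded set_integrable_def]] assms(1)
  by (simp add: set_integrable_def indicator_punctured_scaleR)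

lemma set_integral_punctured_scaleR:
  fixes f :: "real^3 \<Rightarrow> real"
  assumes "c > 0"
  shows "(LINT y:punctured|lborel. f y) = c ^ 3 * (LINT y:punctured|lborel. f (c *\<^sub>R y))"
  using integral_lborel_scaleR[OF assms, of "\<lambda>y. indicator punctured y *\<^sub>R f y"] assms
  by (simp add: set_lebesgue_integral_def indicator_punctured_scaleR)


subsection \<open>Compactly supported functions and Radon measures on the punctured space\<close>

lemma space_punctured_borel [simp]: "space punctured_borel = punctured"
  by (simp add: punctured_borel_def space_restrict_space)

lemma borel_measurable_punctured_continuous:
  fixes f :: "real^3 \<Rightarrow> real"
  shows "continuous_on punctured f \<Longrightarrow> f \<in> borel_measurable punctured_borel"
  unfolding punctured_borel_def by (rule borel_measurable_continuous_on_restrict)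

lemma measurable_scaleR_punctured:
  "(c::real) > 0 \<Longrightarrow> (\<lambda>x. c *\<^sub>R x) \<in> measurable punctured_borel punctured_borel"
  unfolding punctured_borel_def by (intro measurable_restrict_space3) auto

lemma continuous_on_punctured_scaleR:
  fixes f :: "real^3 \<Rightarrow> real"
  assumes "continuous_on punctured f" "c > 0"
  shows "continuous_on punctured (\<lambda>x. a * f (c *\<^sub>R x))"
  using assms by (intro continuous_intros continuous_on_compose2[OF assms(1)]) auto

text \<open>Dilation changes the weighted integral only by a finite factor, and the pointwise bound
  \<open>C\<close> becomes \<open>a * C / c\<close>.\<close>

lemma test_fun_scale:
  assumes f: "f \<in> test_fun \<rho>" and c: "c > 0" and a: "a > 0"
  shows "(\<lambda>x. a * f (c *\<^sub>R x)) \<in> test_fun \<rho>"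
proof -
  obtain C where C: "C > 0" "\<And>x. x \<noteq> 0 \<Longrightarrow> 0 \<le> f x" "\<And>x. x \<noteq> 0 \<Longrightarrow> f x \<le> C * (1 / norm x)"
    and cont: "continuous_on punctured f"
    using f by (auto simp: test_fun_def)
  have [measurable]: "f \<in> borel_measurable (restrict_space borel punctured)"
    using f by (simp add: test_fun_def weighted_Lp_def punctured_borel_def)
  \<comment> \<open>Extension by 0 to the origin, so that the function is Borel on the whole space
    and the substitution rule applies.\<close>
  define g where "g x = (if x \<in> punctured then f x else 0)" for x
  have [measurable]: "g \<in> borel_measurable borel"
    unfolding g_def by (rule measurable_restrict_space_iff[THEN iffD1]) auto
  define h where "h f x = ennreal (1 / norm x * \<bar>f x\<bar> powr \<rho>) * indicator punctured x"
    for f :: "real^3 \<Rightarrow> real" and x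
  have hg: "h f = h g"
    by (auto simp: h_def g_def fun_eq_iff indicator_def)
  have [measurable]: "h g \<in> borel_measurable borel"
    unfolding h_def by measurable
  have "(\<integral>\<^sup>+x. h f x \<partial>lborel) < \<infinity>"
    using f by (simp add: test_fun_def weighted_Lp_def h_def)
  then have fin: "(\<integral>\<^sup>+x. h g (c *\<^sub>R x) \<partial>lborel) < \<infinity>"
    unfolding hg using nn_integral_lborel_scaleR[of c "h g"] c by (auto simp: ennreal_mult_less_top)
  \<comment> \<open>The weight \<open>1 / norm x\<close> contributes the factor \<open>c\<close>; at
    the origin the indicator makes both sides 0.\<close>
  have "h (\<lambda>x. a * f (c *\<^sub>R x)) x = ennreal (c * a powr \<rho>) * h f (c *\<^sub>R x)" for x
  proof (cases "x = 0")
    case False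
    then have "1 / norm x * \<bar>a * f (c *\<^sub>R x)\<bar> powr \<rho>
        = (c * a powr \<rho>) * (1 / norm (c *\<^sub>R x) * \<bar>f (c *\<^sub>R x)\<bar> powr \<rho>)"
      using a c by (simp add: abs_mult powr_mult)
    then have "ennreal (1 / norm x * \<bar>a * f (c *\<^sub>R x)\<bar> powr \<rho>)
        = ennreal (c * a powr \<rho>) * ennreal (1 / norm (c *\<^sub>R x) * \<bar>f (c *\<^sub>R x)\<bar> powr \<rho>)"
      using c by (simp only:) (rule ennreal_mult, auto)
    then show ?thesis
      using False c by (simp add: h_def)
  qed (simp add: h_def)
  then have "(\<integral>\<^sup>+x. h (\<lambda>x. a * f (c *\<^sub>R x)) x \<partial>lborel)
      = ennreal (c * a powr \<rho>) * (\<integral>\<^sup>+x. h g (c *\<^sub>R x) \<partial>lborel)"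
    by (simp add: hg nn_integral_cmult)
  also have "\<dots> < \<infinity>"
    using fin by (simp add: ennreal_mult_less_top)
  finally have "(\<lambda>x. a * f (c *\<^sub>R x)) \<in> weighted_Lp \<rho>"
    using borel_measurable_punctured_continuous[OF continuous_on_punctured_scaleR[OF cont c]]
    by (simp add: weighted_Lp_def h_def)
  moreover have "0 \<le> a * f (c *\<^sub>R x) \<and> a * f (c *\<^sub>R x) \<le> a * C / c * (1 / norm x)"
    if "x \<noteq> 0" for x
    using C(2,3)[of "c *\<^sub>R x"] mult_left_mono[of "f (c *\<^sub>R x)" "C * (1 / norm (c *\<^sub>R x))" a] that c a
    by (simp add: mult.assoc)
  moreover have "a * C / c > 0"
    using a c C(1) by simp
  ultimately show ?thesis
    using continuous_on_punctured_scaleR[OF cont c] unfolding test_fun_def by blast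
qed

lemma compact_support_fun_scale:
  assumes f: "f \<in> compact_support_fun" and c: "c > 0"
  shows "(\<lambda>x. a * f (c *\<^sub>R x)) \<in> compact_support_fun"
proof -
  obtain K where K: "compact K" "K \<subseteq> punctured" "\<And>x. x \<in> punctured - K \<Longrightarrow> f x = 0"
    and cont: "continuous_on punctured f"
    using f by (auto simp: compact_support_fun_def)
  have "compact ((\<lambda>x. (1 / c) *\<^sub>R x) ` K)"
    by (intro compact_scaling K)
  moreover have "(\<lambda>x. (1 / c) *\<^sub>R x) ` K \<subseteq> punctured"
    using K c by auto
  moreover have "a * f (c *\<^sub>R x) = 0" if "x \<in> punctured - (\<lambda>x. (1 / c) *\<^sub>R x) ` K" for x
  proof -
    have "x = (1 / c) *\<^sub>R (c *\<^sub>R x)"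
      using c by simp
    then have "c *\<^sub>R x \<notin> K"
      using that by blast
    then show ?thesis
      using K(3)[of "c *\<^sub>R x"] that c by simp
  qed
  ultimately show ?thesis
    using continuous_on_punctured_scaleR[OF cont c] unfolding compact_support_fun_def by blast
qed

lemma compact_support_fun_measurable:
  "f \<in> compact_support_fun \<Longrightarrow> f \<in> borel_measurable punctured_borel"
  by (simp add: compact_support_fun_def borel_measurable_punctured_continuous)

text \<open>Continuity bounds \<open>f\<close> on its compact support. The indicator form is a
  dominating function for integrals; the origin is left out because the value there is
  arbitrary.\<close>

lemma compact_support_fun_bound:
  assumes "f \<in> compact_support_fun"
  obtains K B where "compact K" "K \<subseteq> punctured" "B > 0"
    "\<And>x. x \<noteq> 0 \<Longrightarrow> \<bar>f x\<bar> \<le> B * indicator K x"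
proof -
  obtain K where K: "compact K" "K \<subseteq> punctured" "\<And>x. x \<in> punctured - K \<Longrightarrow> f x = 0"
    and cont: "continuous_on punctured f"
    using assms by (auto simp: compact_support_fun_def)
  have "compact (f ` K)"
    using K cont by (intro compact_continuous_image) (auto intro: continuous_on_subset)
  then obtain B where B: "B > 0" "\<And>x. x \<in> K \<Longrightarrow> norm (f x) \<le> B"
    using compact_imp_bounded[of "f ` K"] unfolding bounded_pos by auto
  show ?thesis
    using K B by (intro that[OF K(1,2) B(1)]) (auto simp: indicator_def)
qed

lemma compact_support_fun_add:
  assumes "f \<in> compact_support_fun" "g \<in> compact_support_fun"
  shows "(\<lambda>x. f x + g x) \<in> compact_support_fun"
proof -
  obtain K L where "compact K" "K \<subseteq> punctured" "\<And>x. x \<in> punctured - K \<Longrightarrow> f x = 0"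
    "compact L" "L \<subseteq> punctured" "\<And>x. x \<in> punctured - L \<Longrightarrow> g x = 0"
    "continuous_on punctured f" "continuous_on punctured g"
    using assms by (auto simp: compact_support_fun_def)
  then show ?thesis
    unfolding compact_support_fun_def
    by (intro CollectI conjI exI[of _ "K \<union> L"] continuous_intros) auto
qed

lemma compact_support_fun_cmult:
  "f \<in> compact_support_fun \<Longrightarrow> (\<lambda>x. a * f x) \<in> compact_support_fun"
  using compact_support_fun_scale[of f 1 a] by simp

lemma compact_support_fun_uminus:
  "f \<in> compact_support_fun \<Longrightarrow> (\<lambda>x. - f x) \<in> compact_support_fun"
  using compact_support_fun_cmult[of f "-1"] by simp

lemma compact_support_fun_dominated:
  assumes "f \<in> compact_support_fun" "continuous_on punctured g"
    and "\<And>x. x \<noteq> 0 \<Longrightarrow> 0 \<le> g x \<and> g x \<le> f x"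
  shows "g \<in> compact_support_fun"
  using assms unfolding compact_support_fun_def by (force intro: order.antisym)

text \<open>These functions serve both sides of the argument: they are admissible data for the
  log-Laplace equation, and their pairings generate the vague Borel sets.\<close>

definition compact_support_pos :: "(real^3 \<Rightarrow> real) set"
  where "compact_support_pos = {f \<in> compact_support_fun. \<forall>x\<in>punctured. 0 \<le> f x}"

lemma compact_support_posD: "f \<in> compact_support_pos \<Longrightarrow> f \<in> compact_support_fun"
  by (simp add: compact_support_pos_def)

lemma compact_support_pos_scale:
  "f \<in> compact_support_pos \<Longrightarrow> c > 0 \<Longrightarrow> a \<ge> 0 \<Longrightarrow> (\<lambda>x. a * f (c *\<^sub>R x)) \<in> compact_support_pos"
  by (auto simp: compact_support_pos_def intro: compact_support_fun_scale)

text \<open>A compact set off the origin lies in \<open>d \<le> norm x \<le> R\<close> with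
  \<open>d > 0\<close>. So the weight is at most \<open>1 / d\<close> on the support, and a bound
  \<open>B\<close> for \<open>f\<close> gives \<open>f x \<le> B * R / norm x\<close>.\<close>

lemma compact_support_pos_subset_test_fun:
  assumes "\<rho> \<ge> 0"
  shows "compact_support_pos \<subseteq> test_fun \<rho>"
proof
  fix f assume f: "f \<in> compact_support_pos"
  then have fc: "f \<in> compact_support_fun" and cont: "continuous_on punctured f"
    and pos: "\<And>x. x \<noteq> 0 \<Longrightarrow> 0 \<le> f x"
    by (auto simp: compact_support_pos_def compact_support_fun_def)
  obtain K B where KB: "compact K" "K \<subseteq> punctured" "B > 0"
    "\<And>x. x \<noteq> 0 \<Longrightarrow> \<bar>f x\<bar> \<le> B * indicator K x"
    using compact_support_fun_bound[OF fc] by metis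
  obtain d where d: "d > 0" "\<And>x. x \<in> K \<Longrightarrow> d \<le> norm x"
    using separate_point_closed[OF compact_imp_closed[OF KB(1)], of 0] KB(2) by auto
  obtain R where R: "R > 0" "\<And>x. x \<in> K \<Longrightarrow> norm x \<le> R"
    using compact_imp_bounded[OF KB(1)] unfolding bounded_pos by auto
  show "f \<in> test_fun \<rho>"
    unfolding test_fun_def weighted_Lp_def
  proof (intro CollectI conjI exI[of _ "B * R"] ballI)
    show "continuous_on punctured f" "f \<in> borel_measurable punctured_borel"
      using cont by (auto intro: borel_measurable_punctured_continuous)
    have "ennreal (1 / norm x * \<bar>f x\<bar> powr \<rho>) * indicator punctured x
        \<le> ennreal (1 / d * B powr \<rho>) * indicator K x" for x
    proof (cases "x \<in> K")
      case True
      then have "1 / norm x * \<bar>f x\<bar> powr \<rho> \<le> 1 / d * B powr \<rho>"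
        using d KB(2,3) KB(4)[of x] assms
        by (intro mult_mono powr_mono2 divide_left_mono) (auto intro: mult_pos_pos)
      then show ?thesis
        using True by (auto simp: indicator_def intro: ennreal_leI)
    next
      case False
      then show ?thesis
        using KB(4)[of x] by (cases "x = 0") auto
    qed
    then have "(\<integral>\<^sup>+x\<in>punctured. ennreal (1 / norm x * \<bar>f x\<bar> powr \<rho>) \<partial>lborel)
        \<le> (\<integral>\<^sup>+x. ennreal (1 / d * B powr \<rho>) * indicator K x \<partial>lborel)"
      by (rule nn_integral_mono)
    also have "\<dots> = ennreal (1 / d * B powr \<rho>) * emeasure lborel K"
      using KB(1) by (intro nn_integral_cmult_indicator) (auto intro: borel_compact)
    also have "\<dots> < \<infinity>"
      using emeasure_compact_finite[OF KB(1)] by (simp add: ennreal_mult_less_top)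
    finally show "(\<integral>\<^sup>+x\<in>punctured. ennreal (1 / norm x * \<bar>f x\<bar> powr \<rho>) \<partial>lborel) < \<infinity>" .
    show "B * R > 0"
      using KB R by simp
    fix x :: "real^3" assume "x \<in> punctured"
    then have "norm x * f x \<le> B * R"
      using pos[of x] KB(3) KB(4)[of x] R(1) R(2)[of x] mult_mono[of "norm x" R "f x" B]
      by (cases "x \<in> K") (auto simp: mult.commute)
    with \<open>x \<in> punctured\<close> show "0 \<le> f x" "f x \<le> B * R * (1 / norm x)"
      using pos[of x] by (auto simp: field_simps)
  qed
qed


section \<open>Pairings with Radon measures on the punctured space\<close>

lemma scale_measure_eq_density: "scale_measure r M = density M (\<lambda>_. r)"
  by (rule measure_eqI) (simp_all add: emeasure_density nn_integral_cmult_indicator)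

lemma radon_measure_sets: "radon_measure \<mu> \<Longrightarrow> sets \<mu> = sets punctured_borel"
  unfolding radon_measure_def by blast

lemma radon_measure_compact:
  "radon_measure \<mu> \<Longrightarrow> compact K \<Longrightarrow> K \<subseteq> punctured \<Longrightarrow> emeasure \<mu> K < \<infinity>"
  unfolding radon_measure_def by blast

lemma radon_measure_space: "radon_measure \<mu> \<Longrightarrow> space \<mu> = punctured"
  using sets_eq_imp_space_eq[OF radon_measure_sets] by simp

lemma radon_measure_measurable:
  "radon_measure \<mu> \<Longrightarrow> f \<in> measurable punctured_borel N \<Longrightarrow> f \<in> measurable \<mu> N"
  using measurable_cong_sets[OF radon_measure_sets refl] by blast

lemma compact_sets_punctured_borel:
  "compact K \<Longrightarrow> K \<subseteq> punctured \<Longrightarrow> K \<in> sets punctured_borel"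
  unfolding punctured_borel_def by (subst sets_restrict_space_iff) (auto intro: borel_compact)

text \<open>\<open>f\<close> is dominated by a multiple of the indicator of a compact set, which has
  finite measure.\<close>

lemma integrable_compact_support_fun:
  assumes \<mu>: "radon_measure \<mu>" and f: "f \<in> compact_support_fun"
  shows "integrable \<mu> f"
proof -
  obtain K B where KB: "compact K" "K \<subseteq> punctured" "B > 0"
    "\<And>x. x \<noteq> 0 \<Longrightarrow> \<bar>f x\<bar> \<le> B * indicator K x"
    using compact_support_fun_bound[OF f] by metis
  have "integrable \<mu> (\<lambda>x. B * indicator K x)"
    using \<mu> radon_measure_compact[OF \<mu> KB(1,2)] compact_sets_punctured_borel[OF KB(1,2)]
    by (intro integrable_mult_right integrable_real_indicator) (auto simp: radon_measure_sets)
  then show ?thesis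
  proof (rule Bochner_Integration.integrable_bound)
    show "f \<in> borel_measurable \<mu>"
      by (rule radon_measure_measurable[OF \<mu> compact_support_fun_measurable[OF f]])
    show "AE x in \<mu>. norm (f x) \<le> norm (B * indicator K x)"
      using KB(3,4) by (intro AE_I2) (auto simp: radon_measure_space[OF \<mu>])
  qed
qed

lemma pairing_add:
  "radon_measure \<mu> \<Longrightarrow> f \<in> compact_support_fun \<Longrightarrow> g \<in> compact_support_fun \<Longrightarrow>
    pairing \<mu> (\<lambda>x. f x + g x) = pairing \<mu> f + pairing \<mu> g"
  by (simp add: pairing_def integrable_compact_support_fun)

lemma pairing_cmult: "pairing \<mu> (\<lambda>x. a * f x) = a * pairing \<mu> f"
  by (simp add: pairing_def)

lemma pairing_uminus: "pairing \<mu> (\<lambda>x. - f x) = - pairing \<mu> f"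
  by (simp add: pairing_def)

lemma pairing_mono:
  "radon_measure \<mu> \<Longrightarrow> f \<in> compact_support_fun \<Longrightarrow> g \<in> compact_support_fun \<Longrightarrow>
    (\<And>x. x \<noteq> 0 \<Longrightarrow> f x \<le> g x) \<Longrightarrow> pairing \<mu> f \<le> pairing \<mu> g"
  unfolding pairing_def
  by (intro integral_mono integrable_compact_support_fun) (auto simp: radon_measure_space)

lemma pairing_nonneg:
  "radon_measure \<mu> \<Longrightarrow> f \<in> compact_support_pos \<Longrightarrow> 0 \<le> pairing \<mu> f"
  unfolding pairing_def
  by (intro Bochner_Integration.integral_nonneg) (auto simp: radon_measure_space compact_support_pos_def)

section \<open>Dilating and rescaling measures\<close>

lemma measurable_dilate:
  assumes "c > 0" "sets \<nu> = sets punctured_borel"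
  shows "(\<lambda>x. x /\<^sub>R c) \<in> measurable \<nu> punctured_borel"
  unfolding measurable_cong_sets[OF assms(2) refl]
  using measurable_scaleR_punctured[of "inverse c"] assms(1) by simp

lemma nn_integral_scale_dilate:
  assumes c: "c > 0" and \<nu>: "sets \<nu> = sets punctured_borel"
    and f: "f \<in> borel_measurable punctured_borel"
  shows "(\<integral>\<^sup>+x. f x \<partial>scale_measure r (dilate c \<nu>)) = r * (\<integral>\<^sup>+x. f (x /\<^sub>R c) \<partial>\<nu>)"
  using f by (simp add: nn_integral_scale_measure dilate_def nn_integral_distr measurable_dilate[OF c \<nu>])

lemma pairing_scale_dilate:
  assumes c: "c > 0" and a: "a \<ge> 0" and \<nu>: "sets \<nu> = sets punctured_borel"
    and f: "f \<in> borel_measurable punctured_borel"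
  shows "pairing (scale_measure (ennreal a) (dilate c \<nu>)) f = pairing \<nu> (\<lambda>x. a * f (x /\<^sub>R c))"
  \<comment> \<open>Writing the mass factor as a constant density makes the Bochner integral
    computable by the density rule.\<close>
  using f a
  by (simp add: pairing_def scale_measure_eq_density integral_density dilate_def
      integral_distr[OF measurable_dilate[OF c \<nu>]])

text \<open>Dilation is a homeomorphism of the punctured space, so it matches the compact subsets of
  \<open>A\<close> with those of the dilated set and carries inner regularity over.\<close>

lemma radon_measure_scale_dilate:
  assumes \<nu>: "radon_measure \<nu>" and c: "c > 0"
  shows "radon_measure (scale_measure (ennreal a) (dilate c \<nu>))" (is "radon_measure ?\<mu>")
proof -
  have sets: "sets ?\<mu> = sets punctured_borel"
    by (simp add: dilate_def)
  have em: "emeasure ?\<mu> A = ennreal a * emeasure \<nu> ((\<lambda>x. c *\<^sub>R x) ` A)"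
    if "A \<in> sets punctured_borel" for A
    using emeasure_dilate[OF c radon_measure_sets[OF \<nu>] that] by simp
  have comp: "compact ((\<lambda>x. c *\<^sub>R x) ` K)" "(\<lambda>x. c *\<^sub>R x) ` K \<subseteq> punctured"
    if "compact K" "K \<subseteq> punctured" for K
    using that c by (auto intro: compact_scaling)
  have "emeasure ?\<mu> K < \<infinity>" if "compact K" "K \<subseteq> punctured" for K
    using radon_measure_compact[OF \<nu> comp[OF that]] em[OF compact_sets_punctured_borel[OF that]]
    by (simp add: ennreal_mult_less_top)
  moreover have "emeasure ?\<mu> A = (SUP K\<in>{K. compact K \<and> K \<subseteq> A}. emeasure ?\<mu> K)"
    if A: "A \<in> sets ?\<mu>" for A
  proof -
    have A': "A \<in> sets punctured_borel" "A \<subseteq> punctured"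
      using A sets.sets_into_space[of A punctured_borel] sets by auto
    \<comment> \<open>The dilated set is a preimage under the inverse dilation, hence measurable,
      and inner regularity of \<open>\<nu>\<close> applies to it.\<close>
    have "(\<lambda>x. inverse c *\<^sub>R x) -` A \<inter> space punctured_borel \<in> sets punctured_borel"
      using measurable_scaleR_punctured[of "inverse c"] A' c by (intro measurable_sets) auto
    also have "(\<lambda>x. inverse c *\<^sub>R x) -` A \<inter> space punctured_borel = (\<lambda>x. c *\<^sub>R x) ` A"
      using A' c by (force simp: image_iff)
    finally have "(\<lambda>x. c *\<^sub>R x) ` A \<in> sets \<nu>"
      by (simp add: radon_measure_sets[OF \<nu>])
    then have "emeasure \<nu> ((\<lambda>x. c *\<^sub>R x) ` A)
        = (SUP K\<in>{K. compact K \<and> K \<subseteq> (\<lambda>x. c *\<^sub>R x) ` A}. emeasure \<nu> K)"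
      using \<nu> unfolding radon_measure_def by blast
    also have "{K. compact K \<and> K \<subseteq> (\<lambda>x. c *\<^sub>R x) ` A}
        = (\<lambda>K. (\<lambda>x. c *\<^sub>R x) ` K) ` {K. compact K \<and> K \<subseteq> A}" (is "?L = ?R")
    proof
      show "?R \<subseteq> ?L"
        by (auto intro: compact_scaling)
      show "?L \<subseteq> ?R"
      proof
        fix K assume K: "K \<in> ?L"
        have "K = (\<lambda>x. c *\<^sub>R x) ` (\<lambda>x. inverse c *\<^sub>R x) ` K"
          using c by (simp add: image_image)
        moreover have "compact ((\<lambda>x. inverse c *\<^sub>R x) ` K)"
          using K by (intro compact_scaling) auto
        moreover have "(\<lambda>x. inverse c *\<^sub>R x) ` K \<subseteq> A"
          using K c by force
        ultimately show "K \<in> ?R"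
          by blast
      qed
    qed
    finally have "emeasure ?\<mu> A = (SUP K\<in>{K. compact K \<and> K \<subseteq> A}.
        ennreal a * emeasure \<nu> ((\<lambda>x. c *\<^sub>R x) ` K))"
      unfolding em[OF A'(1)] by (simp add: image_image SUP_mult_left_ennreal)
    also have "\<dots> = (SUP K\<in>{K. compact K \<and> K \<subseteq> A}. emeasure ?\<mu> K)"
      using A' by (intro SUP_cong refl em[symmetric] compact_sets_punctured_borel) auto
    finally show ?thesis .
  qed
  ultimately show ?thesis
    using sets unfolding radon_measure_def by blast
qed

lemma test_fun_measurable: "f \<in> test_fun \<rho> \<Longrightarrow> f \<in> borel_measurable punctured_borel"
  by (simp add: test_fun_def borel_measurable_punctured_continuous)

text \<open>Integrating a test function against the new measure amounts to integrating its dilation,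
  again a test function, against \<open>\<nu>\<close>.\<close>

lemma state_set_scale_dilate:
  assumes \<nu>: "\<nu> \<in> state_set \<rho>" and c: "c > 0" and a: "a > 0"
  shows "scale_measure (ennreal a) (dilate c \<nu>) \<in> state_set \<rho>"
proof -
  have rad: "radon_measure \<nu>"
    using \<nu> by (simp add: state_set_def)
  have "(\<integral>\<^sup>+x. ennreal (f x) \<partial>scale_measure (ennreal a) (dilate c \<nu>)) < \<infinity>"
    if f: "f \<in> test_fun \<rho>" for f
  proof -
    have "(\<lambda>x. 1 * f (inverse c *\<^sub>R x)) \<in> test_fun \<rho>"
      by (rule test_fun_scale[OF f]) (use c in auto)
    then have "(\<integral>\<^sup>+x. ennreal (f (x /\<^sub>R c)) \<partial>\<nu>) < \<infinity>"
      using \<nu> by (simp add: state_set_def)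
    moreover have "(\<lambda>x. ennreal (f x)) \<in> borel_measurable punctured_borel"
      using test_fun_measurable[OF f] by measurable
    ultimately show ?thesis
      using nn_integral_scale_dilate[OF c radon_measure_sets[OF rad]]
      by (simp add: ennreal_mult_less_top)
  qed
  then show ?thesis
    using radon_measure_scale_dilate[OF rad c] by (simp add: state_set_def)
qed

section \<open>Vague continuity and measurability of rescaling and pairing\<close>

lemma openin_vague_pairing:
  assumes "f \<in> compact_support_fun" "open U"
  shows "openin (vague_topology \<rho>) {\<mu>\<in>state_set \<rho>. pairing \<mu> f \<in> U}"
  unfolding vague_topology_def by (rule topology_generated_by_Basis) (use assms in blast)

text \<open>The preimage of a subbasic set is the subbasic set of the dilated and rescaled test
  function.\<close>

lemma continuous_map_scale_dilate:
  assumes c: "c > 0" and a: "a > 0"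
  shows "continuous_map (vague_topology \<rho>) (vague_topology \<rho>)
    (\<lambda>\<nu>. scale_measure (ennreal a) (dilate c \<nu>))" (is "continuous_map _ _ ?T")
proof -
  have "openin (vague_topology \<rho>) (?T -` {\<mu>\<in>state_set \<rho>. pairing \<mu> f \<in> U} \<inter> state_set \<rho>)"
    if f: "f \<in> compact_support_fun" and U: "open U" for f U
  proof -
    have "pairing (?T \<nu>) f = pairing \<nu> (\<lambda>x. a * f (inverse c *\<^sub>R x))" if "\<nu> \<in> state_set \<rho>" for \<nu>
      using that a by (intro pairing_scale_dilate[OF c] compact_support_fun_measurable f)
        (auto simp: state_set_def radon_measure_sets)
    then have "?T -` {\<mu>\<in>state_set \<rho>. pairing \<mu> f \<in> U} \<inter> state_set \<rho>
        = {\<nu>\<in>state_set \<rho>. pairing \<nu> (\<lambda>x. a * f (inverse c *\<^sub>R x)) \<in> U}"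
      using state_set_scale_dilate[OF _ c a] by auto
    then show ?thesis
      using compact_support_fun_scale[OF f, of "inverse c" a] c U by (simp add: openin_vague_pairing)
  qed
  \<comment> \<open>Continuity into a generated topology also asks that the image lie in the union
    of the generators, here the whole state set.\<close>
  moreover have "?T ` state_set \<rho> \<subseteq> \<Union> {{\<mu>\<in>state_set \<rho>. pairing \<mu> f \<in> U} | f U.
      f \<in> compact_support_fun \<and> open U}"
    using state_set_scale_dilate[OF _ c a]
      topspace_vague_topology[of \<rho>, unfolded vague_topology_def topology_generated_by_topspace] by blast
  ultimately show ?thesis
    by (subst (2) vague_topology_def, intro continuous_on_generated_topo)
      (auto simp: topspace_vague_topology)
qed

lemma measurable_scale_dilate:
  assumes "c > 0" "a > 0"
  shows "(\<lambda>\<nu>. scale_measure (ennreal a) (dilate c \<nu>)) \<in> measurable (state_space \<rho>) (state_space \<rho>)"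
proof -
  have "(\<lambda>\<nu>. scale_measure (ennreal a) (dilate c \<nu>)) -` U \<inter> state_set \<rho> \<in> sets (state_space \<rho>)"
    if "openin (vague_topology \<rho>) U" for U
    using continuous_map_scale_dilate[OF assms, of \<rho>] that
    by (auto simp: continuous_map_alt topspace_vague_topology sets_state_space)
  moreover have "{U. openin (vague_topology \<rho>) U} \<subseteq> Pow (state_set \<rho>)"
    using openin_subset[of "vague_topology \<rho>"] by (auto simp: topspace_vague_topology)
  ultimately show ?thesis
    using state_set_scale_dilate[OF _ assms]
    by (subst (2) state_space_def, intro measurable_measure_of) (simp_all add: space_state_space Pi_iff)
qed

lemma measurable_pairing:
  assumes "f \<in> compact_support_fun"
  shows "(\<lambda>\<mu>. pairing \<mu> f) \<in> borel_measurable (state_space \<rho>)"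
proof (rule borel_measurableI)
  fix U :: "real set" assume "open U"
  then have "{\<mu>\<in>state_set \<rho>. pairing \<mu> f \<in> U} \<in> sets (state_space \<rho>)"
    using openin_vague_pairing[OF assms] by (auto simp: sets_state_space)
  also have "{\<mu>\<in>state_set \<rho>. pairing \<mu> f \<in> U}
      = (\<lambda>\<mu>. pairing \<mu> f) -` U \<inter> space (state_space \<rho>)"
    by (auto simp: space_state_space)
  finally show "(\<lambda>\<mu>. pairing \<mu> f) -` U \<inter> space (state_space \<rho>) \<in> sets (state_space \<rho>)" .
qed

subsection \<open>Scaling of the log-Laplace equation\<close>

text \<open>The exponent \<open>r^2 / (4 * t)\<close> is invariant under parabolic scaling; only the
  prefactor changes.\<close>

lemma heat_scale:
  assumes "k > 0" "t > 0"
  shows "heat (k * t) (sqrt k * r) = k powr (- 3/2) * heat t r"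
  using assms by (simp add: heat_def powr_mult power_mult_distrib)

text \<open>All three terms acquire the factor \<open>k powr (- 3/2)\<close>, since the ratio of
  \<open>t\<close> to \<open>norm x * norm y\<close> is invariant. In the last term the Jacobian
  \<open>sqrt k\<close> of the \<open>u\<close> substitution turns the coefficient
  \<open>\<alpha>\<close> into \<open>sqrt k * \<alpha>\<close>, matching the change in the
  exponent.\<close>

lemma point_heat_kernel_scale:
  assumes "k > 0" "t > 0"
  shows "point_heat_kernel \<alpha> (k * t) (sqrt k *\<^sub>R x) (sqrt k *\<^sub>R y)
    = k powr (- 3/2) * point_heat_kernel (sqrt k * \<alpha>) t x y"
proof -
  have s: "sqrt k > 0" "sqrt k * sqrt k = k"
    using assms by simp_all
  have 1: "heat (k * t) (norm (sqrt k *\<^sub>R y - sqrt k *\<^sub>R x)) = k powr (- 3/2) * heat t (norm (y - x))"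
    using heat_scale[OF assms, of "norm (y - x)"] assms by (simp flip: scaleR_diff_right)
  have "norm (sqrt k *\<^sub>R x) * norm (sqrt k *\<^sub>R y) = sqrt k * sqrt k * (norm x * norm y)"
    using assms by (simp only: norm_scaleR real_sqrt_abs2 abs_of_pos[OF s(1)] mult_ac)
  then have n: "norm (sqrt k *\<^sub>R x) * norm (sqrt k *\<^sub>R y) = k * (norm x * norm y)"
    unfolding s(2) .
  have 2: "2 * (k * t) / (norm (sqrt k *\<^sub>R x) * norm (sqrt k *\<^sub>R y))
      = 2 * t / (norm x * norm y)"
    and 5: "8 * pi * \<alpha> * (k * t) / (norm (sqrt k *\<^sub>R x) * norm (sqrt k *\<^sub>R y))
      = 8 * pi * \<alpha> * t / (norm x * norm y)"
    unfolding n using assms by simp_all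
  have 3: "norm (sqrt k *\<^sub>R x) + norm (sqrt k *\<^sub>R y) = sqrt k * (norm x + norm y)"
    using assms by (simp add: distrib_left)
  let ?g = "\<lambda>u. indicator {0..} u *
      (exp (- (4 * pi * \<alpha> * u)) * heat (k * t) (u + norm (sqrt k *\<^sub>R x) + norm (sqrt k *\<^sub>R y)))"
  have "(LINT u|lborel. ?g u) = sqrt k * (LINT u|lborel. ?g (sqrt k * u))"
    using lborel_integral_real_affine[of "sqrt k" ?g 0] s by simp
  also have "(\<lambda>u. ?g (sqrt k * u)) = (\<lambda>u. k powr (- 3/2) * (indicator {0..} u *
      (exp (- (4 * pi * (sqrt k * \<alpha>) * u)) * heat t (u + norm x + norm y))))"
  proof
    fix u :: real
    have "sqrt k * u + norm (sqrt k *\<^sub>R x) + norm (sqrt k *\<^sub>R y) = sqrt k * (u + norm x + norm y)"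
      using assms by (simp add: distrib_left)
    then show "?g (sqrt k * u) = k powr (- 3/2) * (indicator {0..} u *
      (exp (- (4 * pi * (sqrt k * \<alpha>) * u)) * heat t (u + norm x + norm y)))"
      using heat_scale[OF assms, of "u + norm x + norm y"] s(1)
      by (simp add: indicator_def zero_le_mult_iff mult_ac)
  qed
  finally have 4: "(LINT u:{0..}|lborel. exp (- (4 * pi * \<alpha> * u)) *
        heat (k * t) (u + norm (sqrt k *\<^sub>R x) + norm (sqrt k *\<^sub>R y)))
      = sqrt k * (k powr (- 3/2) * (LINT u:{0..}|lborel.
        exp (- (4 * pi * (sqrt k * \<alpha>) * u)) * heat t (u + norm x + norm y)))"
    by (simp add: set_lebesgue_integral_def)
  show ?thesis
    unfolding point_heat_kernel_def 1 2 5 4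
    unfolding 3 heat_scale[OF assms] by (simp add: algebra_simps)
qed

text \<open>The Jacobian of \<open>sqrt k\<close> dilation in dimension three cancels the scaling
  factor of the kernel.\<close>

lemma sqrt_cubed_powr:
  assumes "k > 0"
  shows "sqrt k ^ 3 * k powr (- 3/2) = 1"
proof -
  have "sqrt k ^ 3 = k powr (3/2)"
    using assms by (simp add: powr_half_sqrt[symmetric] powr_powr flip: powr_realpow)
  then show ?thesis
    using assms by (simp flip: powr_add)
qed

text \<open>Multiply the equation for \<open>v\<close> by \<open>b = k powr (1/\<beta>)\<close>. In
  the linear term \<open>b\<close> cancels the factor of the datum; in the nonlinear term
  \<open>b powr \<beta> = k\<close> is exactly the Jacobian of the time substitution.\<close>

lemma mild_solution_scale:
  assumes k: "k > 0" and \<beta>: "\<beta> > 0"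
    and v: "mild_solution \<eta> \<beta> \<rho> \<alpha> (\<lambda>x. k powr (- 1/\<beta>) * \<phi> (x /\<^sub>R sqrt k)) v"
  shows "mild_solution \<eta> \<beta> \<rho> (sqrt k * \<alpha>) \<phi>
    (\<lambda>t x. k powr (1/\<beta>) * v (k * t) (sqrt k *\<^sub>R x))"
  unfolding mild_solution_def
proof (intro conjI allI impI ballI)
  define b where "b = k powr (1/\<beta>)"
  define c where "c = sqrt k"
  define r where "r = k powr (- 3/2)"
  define p where "p = point_heat_kernel \<alpha>"
  define q where "q = point_heat_kernel (c * \<alpha>)"
  have b: "b > 0" "b * k powr (- 1/\<beta>) = 1"
    using k by (simp_all add: b_def flip: powr_add)
  have c: "c > 0" "c ^ 3 * r = 1" and r: "r > 0"
    using k sqrt_cubed_powr[OF k] by (simp_all add: c_def r_def)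
  have pq: "p (k * t) (c *\<^sub>R x) (c *\<^sub>R y) = r * q t x y" if "t > 0" for t x y
    using point_heat_kernel_scale[OF k that] by (simp add: p_def q_def c_def r_def)
  have vt: "v t \<in> test_fun \<rho>" if "t > 0" for t
    using v that by (simp add: mild_solution_def)
  note v' = v[unfolded mild_solution_def, folded c_def p_def b_def, THEN conjunct2, rule_format]
  have bk: "(b * z) powr (1 + \<beta>) = b * k * z powr (1 + \<beta>)" if "z \<ge> 0" for z
  proof -
    have "b powr (1 + \<beta>) = b * k"
      using k \<beta> by (simp add: b_def powr_powr flip: powr_add) (simp add: powr_add add_divide_distrib)
    then show ?thesis
      using that b by (simp add: powr_mult)
  qed
  have v0: "v (k * s) (c *\<^sub>R y) \<ge> 0" if "s > 0" "y \<noteq> 0" for s y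
  proof -
    have "\<forall>z\<in>punctured. 0 \<le> v (k * s) z"
      using vt[of "k * s"] that k by (auto simp: test_fun_def)
    then show ?thesis
      using that c by simp
  qed
  fix t :: real assume t: "t > 0"
  then have kt: "k * t > 0"
    using k by simp
  show "(\<lambda>x. k powr (1 / \<beta>) * v (k * t) (sqrt k *\<^sub>R x)) \<in> test_fun \<rho>"
    using test_fun_scale[OF vt[OF kt], of c b] b c by (simp add: b_def c_def)
  fix x :: "real^3" assume x: "x \<in> punctured"
  then have cx: "c *\<^sub>R x \<in> punctured"
    using c by simp
  note vx = v'[OF kt cx]
  have \<phi>_eq: "p (k * t) (c *\<^sub>R x) (c *\<^sub>R y) * (k powr (- 1/\<beta>) * \<phi> ((c *\<^sub>R y) /\<^sub>R c))
      = (r * k powr (- 1/\<beta>)) * (q t x y * \<phi> y)" for y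
    using c pq[OF t] by simp
  have "set_integrable lborel punctured (\<lambda>y. (r * k powr (- 1/\<beta>)) * (q t x y * \<phi> y))"
    using set_integrable_punctured_scaleR[OF c(1) vx[THEN conjunct1]] unfolding \<phi>_eq .
  then show "set_integrable lborel punctured
      (\<lambda>y. point_heat_kernel (sqrt k * \<alpha>) t x y * \<phi> y)"
    using r k by (simp add: q_def c_def)
  have int1: "(LINT y:punctured|lborel. p (k * t) (c *\<^sub>R x) y * (k powr (- 1/\<beta>) * \<phi> (y /\<^sub>R c)))
      = k powr (- 1/\<beta>) * (LINT y:punctured|lborel. q t x y * \<phi> y)"
    unfolding set_integral_punctured_scaleR[OF c(1), of "\<lambda>y. p (k * t) (c *\<^sub>R x) y * _ y"] \<phi>_eq
      set_integral_mult_right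
    using c by (simp flip: mult.assoc)
  have ind: "indicator ({0<..<k * t} \<times> punctured) (k *\<^sub>R s, c *\<^sub>R y)
      = (indicator ({0<..<t} \<times> punctured) (s, y) :: real)" for s y
    using k c by (simp add: indicator_def zero_less_mult_iff)
  \<comment> \<open>The restrictions on \<open>s\<close> and \<open>y\<close> come from the kernel
    scaling, which requires \<open>t - s > 0\<close>, and from the nonnegativity of
    \<open>v\<close>, known for positive times off the origin.\<close>
  have kern: "r * (q (t - s) x y * (b * v (k * s) (c *\<^sub>R y)) powr (1 + \<beta>))
      = (b * k) * (p (k * t - k * s) (c *\<^sub>R x) (c *\<^sub>R y) * v (k * s) (c *\<^sub>R y) powr (1 + \<beta>))"
    if "0 < s" "s < t" "y \<noteq> 0" for s y
    using pq[of "t - s" x y] that v0[of s y] by (simp add: bk right_diff_distrib)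
  have "integrable (lborel \<Otimes>\<^sub>M lborel) (\<lambda>(s, y).
      indicator ({0<..<k * t} \<times> punctured) (k *\<^sub>R s, c *\<^sub>R y) *\<^sub>R
        (p (k * t - k *\<^sub>R s) (c *\<^sub>R x) (c *\<^sub>R y) * v (k *\<^sub>R s) (c *\<^sub>R y) powr (1 + \<beta>)))"
    using integrable_lborel_pair_scaleR[OF k c(1)
        vx[THEN conjunct2, THEN conjunct1, unfolded set_integrable_def]]
    by simp
  \<comment> \<open>By \<open>kern\<close>, the factor \<open>b * k / r\<close> turns this integrand
    into that of the scaled solution. Where \<open>kern\<close> does not apply, the indicator makes
    both vanish.\<close>
  then have "integrable (lborel \<Otimes>\<^sub>M lborel) (\<lambda>z. (b * k / r) * (case z of (s, y) \<Rightarrow>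
      indicator ({0<..<k * t} \<times> punctured) (k *\<^sub>R s, c *\<^sub>R y) *\<^sub>R
        (p (k * t - k *\<^sub>R s) (c *\<^sub>R x) (c *\<^sub>R y) * v (k *\<^sub>R s) (c *\<^sub>R y) powr (1 + \<beta>))))"
    by (rule integrable_mult_right)
  also have "(\<lambda>z. (b * k / r) * (case z of (s, y) \<Rightarrow>
      indicator ({0<..<k * t} \<times> punctured) (k *\<^sub>R s, c *\<^sub>R y) *\<^sub>R
        (p (k * t - k *\<^sub>R s) (c *\<^sub>R x) (c *\<^sub>R y) * v (k *\<^sub>R s) (c *\<^sub>R y) powr (1 + \<beta>))))
    = (\<lambda>z. indicator ({0<..<t} \<times> punctured) z *\<^sub>R (case z of (s, y) \<Rightarrow>
        q (t - s) x y * (b * v (k * s) (c *\<^sub>R y)) powr (1 + \<beta>)))"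
  proof -
    have "(b * k / r) * (p (k * t - k * s) (c *\<^sub>R x) (c *\<^sub>R y) * v (k * s) (c *\<^sub>R y) powr (1 + \<beta>))
        = q (t - s) x y * (b * v (k * s) (c *\<^sub>R y)) powr (1 + \<beta>)"
      if "0 < s" "s < t" "y \<noteq> 0" for s y
      unfolding times_divide_eq_left kern[OF that, symmetric] using r by simp
    then show ?thesis
      unfolding ind fun_eq_iff by (auto simp: indicator_def)
  qed
  finally show "set_integrable (lborel \<Otimes>\<^sub>M lborel) ({0<..<t} \<times> punctured)
      (\<lambda>(s, y). point_heat_kernel (sqrt k * \<alpha>) (t - s) x y *
        (k powr (1 / \<beta>) * v (k * s) (sqrt k *\<^sub>R y)) powr (1 + \<beta>))"
    unfolding set_integrable_def q_def b_def c_def .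
  \<comment> \<open>The Jacobian \<open>c ^ 3\<close> cancels the kernel factor \<open>r\<close>;
    the amplitude and time factors \<open>b * k\<close> remain.\<close>
  have inner: "(LINT y:punctured|lborel. p (k * t - k * s) (c *\<^sub>R x) y * v (k * s) y powr (1 + \<beta>))
      = (LINT y:punctured|lborel. q (t - s) x y * (b * v (k * s) (c *\<^sub>R y)) powr (1 + \<beta>)) / (b * k)"
    (is "?L = ?R / _") if "0 < s" "s < t" for s
  proof -
    have "b * k * ?L = c ^ 3 * (LINT y:punctured|lborel.
        b * k * (p (k * t - k * s) (c *\<^sub>R x) (c *\<^sub>R y) * v (k * s) (c *\<^sub>R y) powr (1 + \<beta>)))"
      unfolding set_integral_punctured_scaleR[OF c(1), of "\<lambda>y. p _ (c *\<^sub>R x) y * _ y"] by simp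
    also have "\<dots> = c ^ 3 * (LINT y:punctured|lborel.
        r * (q (t - s) x y * (b * v (k * s) (c *\<^sub>R y)) powr (1 + \<beta>)))"
      by (intro arg_cong2[where f="(*)"] refl set_lebesgue_integral_cong)
        (use kern that in auto)
    also have "\<dots> = ?R"
      unfolding set_integral_mult_right using c by (simp flip: mult.assoc)
    finally show ?thesis
      using b k by (simp add: field_simps)
  qed
  \<comment> \<open>The time Jacobian \<open>k\<close> cancels the \<open>k\<close> left by
    \<open>inner\<close>. The remaining \<open>1 / b\<close> disappears when the equation is
    multiplied by \<open>b\<close>.\<close>
  have "(LINT s:{0<..<k * t}|lborel. LINT y:punctured|lborel.
        p (k * t - s) (c *\<^sub>R x) y * v s y powr (1 + \<beta>))
      = k * (LINT s:{0<..<t}|lborel. LINT y:punctured|lborel.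
        p (k * t - k * s) (c *\<^sub>R x) y * v (k * s) y powr (1 + \<beta>))"
    unfolding set_lebesgue_integral_def[of lborel "{0<..<_}"] using k
    by (subst lborel_integral_real_affine[of k _ 0])
      (simp_all add: indicator_def zero_less_mult_iff cong: if_cong)
  also have "\<dots> = k * (LINT s:{0<..<t}|lborel. (LINT y:punctured|lborel.
        q (t - s) x y * (b * v (k * s) (c *\<^sub>R y)) powr (1 + \<beta>)) / (b * k))"
    by (intro arg_cong2[where f="(*)"] refl set_lebesgue_integral_cong) (use inner in auto)
  also have "\<dots> = (LINT s:{0<..<t}|lborel. LINT y:punctured|lborel.
        q (t - s) x y * (b * v (k * s) (c *\<^sub>R y)) powr (1 + \<beta>)) / b"
    using k by simp
  finally have int2: "b * (LINT s:{0<..<k * t}|lborel. LINT y:punctured|lborel.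
        p (k * t - s) (c *\<^sub>R x) y * v s y powr (1 + \<beta>))
      = (LINT s:{0<..<t}|lborel. LINT y:punctured|lborel.
        q (t - s) x y * (b * v (k * s) (c *\<^sub>R y)) powr (1 + \<beta>))"
    using b by simp
  have "b * v (k * t) (c *\<^sub>R x) = (LINT y:punctured|lborel. q t x y * \<phi> y)
      - \<eta> * (LINT s:{0<..<t}|lborel. LINT y:punctured|lborel.
          q (t - s) x y * (b * v (k * s) (c *\<^sub>R y)) powr (1 + \<beta>))"
    unfolding int2[symmetric] vx[THEN conjunct2, THEN conjunct2] int1
    using b by (simp add: right_diff_distrib flip: mult.assoc)
  then show "k powr (1 / \<beta>) * v (k * t) (sqrt k *\<^sub>R x)
      = (LINT y:punctured|lborel. point_heat_kernel (sqrt k * \<alpha>) t x y * \<phi> y)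
        - \<eta> * (LINT s:{0<..<t}|lborel. LINT y:punctured|lborel.
          point_heat_kernel (sqrt k * \<alpha>) (t - s) x y *
            (k powr (1 / \<beta>) * v (k * s) (sqrt k *\<^sub>R y)) powr (1 + \<beta>))"
    by (simp add: q_def b_def c_def)
qed

subsection \<open>The Borel sets of the vague topology\<close>

text \<open>The neighbourhood property passes from generators to all open sets, so each open set is
  a union of finite intersections of members of \<open>W\<close>. There are only countably many of
  these, so the union is countable. The factor \<open>S\<close> gives the empty intersection the
  value \<open>S\<close>.\<close>

lemma generated_topology_subset_sigma_sets:
  assumes W: "countable W" "W \<subseteq> Pow S"
    and nbhd: "\<And>B x. B \<in> \<B> \<Longrightarrow> x \<in> B \<Longrightarrow>
      \<exists>ws. finite ws \<and> ws \<subseteq> W \<and> x \<in> S \<inter> \<Inter>ws \<and> S \<inter> \<Inter>ws \<subseteq> B"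
    and V: "generate_topology_on \<B> V"
  shows "V \<in> sigma_sets S W"
proof -
  interpret sigma_algebra S "sigma_sets S W"
    using W(2) by (rule sigma_algebra_sigma_sets)
  have loc: "\<exists>ws. finite ws \<and> ws \<subseteq> W \<and> x \<in> S \<inter> \<Inter>ws \<and> S \<inter> \<Inter>ws \<subseteq> V" if "x \<in> V" for x
    using V that
  proof (induction arbitrary: x)
    case (Int A B)
    obtain ws where "finite ws" "ws \<subseteq> W" "x \<in> S \<inter> \<Inter>ws" "S \<inter> \<Inter>ws \<subseteq> A"
      using Int.IH(1)[of x] Int.prems by auto
    moreover obtain ws' where "finite ws'" "ws' \<subseteq> W" "x \<in> S \<inter> \<Inter>ws'" "S \<inter> \<Inter>ws' \<subseteq> B"
      using Int.IH(2)[of x] Int.prems by auto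
    ultimately show ?case
      by (intro exI[of _ "ws \<union> ws'"]) auto
  next
    case (UN K)
    then show ?case
      by (meson Sup_upper UnionE order.trans)
  qed (use nbhd in auto)
  have meas: "S \<inter> \<Inter>ws \<in> sigma_sets S W" if "finite ws" "ws \<subseteq> W" for ws
    using that
  proof (induction ws)
    case (insert w ws)
    then have "w \<inter> (S \<inter> \<Inter>ws) \<in> sigma_sets S W"
      by (blast intro: Int)
    also have "w \<inter> (S \<inter> \<Inter>ws) = S \<inter> \<Inter>(insert w ws)"
      by auto
    finally show ?case .
  qed simp
  define F where "F = (\<lambda>ws. S \<inter> \<Inter>ws) ` {ws. finite ws \<and> ws \<subseteq> W}"
  have "countable {A \<in> F. A \<subseteq> V}"
    unfolding F_def using countable_Collect_finite_subset[OF W(1)] by (auto intro: countable_subset)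
  moreover have "{A \<in> F. A \<subseteq> V} \<subseteq> sigma_sets S W"
    using meas by (auto simp: F_def)
  ultimately have "\<Union>{A \<in> F. A \<subseteq> V} \<in> sigma_sets S W"
    by (rule countable_Union)
  moreover have "\<exists>A\<in>F. x \<in> A \<and> A \<subseteq> V" if "x \<in> V" for x
    using loc[OF that] unfolding F_def by auto
  then have "\<Union>{A \<in> F. A \<subseteq> V} = V"
    by blast
  ultimately show ?thesis
    by simp
qed

text \<open>An entry \<open>(a, p, q)\<close> is a cone with apex over \<open>a\<close>, slope
  \<open>p\<close> and height \<open>q\<close>. Lists of countable data keep the family of maxima
  countable, and the base value 0 keeps it nonnegative.\<close>

primrec cone_max :: "((real^3) \<times> real \<times> real) list \<Rightarrow> real^3 \<Rightarrow> real"
  where "cone_max [] x = 0"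
  | "cone_max (i # L) x = (case i of (a, p, q) \<Rightarrow> max (q - p * norm (x - a)) (cone_max L x))"

lemma cone_max_le_iff:
  "cone_max L x \<le> y \<longleftrightarrow> 0 \<le> y \<and> (\<forall>(a, p, q)\<in>set L. q - p * norm (x - a) \<le> y)"
  by (induction L) auto

lemma cone_max_nonneg: "0 \<le> cone_max L x"
  using cone_max_le_iff[of L x "cone_max L x"] by simp

lemma cone_max_ge: "(a, p, q) \<in> set L \<Longrightarrow> q - p * norm (x - a) \<le> cone_max L x"
  using cone_max_le_iff[of L x "cone_max L x"] by auto

lemma continuous_on_cone_max: "continuous_on S (cone_max L)"
proof (induction L)
  case (Cons i L)
  have "cone_max (i # L)
      = (\<lambda>x. max (snd (snd i) - fst (snd i) * norm (x - fst i)) (cone_max L x))"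
    by (auto simp: fun_eq_iff split: prod.split)
  with Cons show ?case
    by (auto intro!: continuous_intros)
qed (simp add: continuous_on_const flip: cone_max.simps(1)[abs_def] cong: continuous_on_cong)

text \<open>Take a height \<open>q\<close> between \<open>b\<close> and \<open>f x\<close> and a
  slope so steep that the cone is negative outside the ball where \<open>f\<close> exceeds
  \<open>q\<close>. The strict inequalities leave room to move the apex from \<open>x\<close> into
  \<open>D\<close>.\<close>

lemma cone_below:
  fixes f :: "real^3 \<Rightarrow> real"
  assumes f: "continuous_on punctured f" "\<And>x. x \<noteq> 0 \<Longrightarrow> 0 \<le> f x"
    and D: "\<And>U. open U \<Longrightarrow> U \<noteq> {} \<Longrightarrow> \<exists>d\<in>D. d \<in> U"
    and x: "x \<noteq> 0" and b: "0 \<le> b" "b < f x"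
  obtains a p q where "a \<in> D" "p \<in> \<rat>" "q \<in> \<rat>" "b < q - p * norm (x - a)"
    "\<And>y. y \<noteq> 0 \<Longrightarrow> q - p * norm (y - a) \<le> f y"
proof -
  obtain q where q: "q \<in> \<rat>" "b < q" "q < f x"
    using Rats_dense_in_real[OF b(2)] by blast
  obtain d where d: "d > 0" "\<And>y. y \<noteq> 0 \<Longrightarrow> dist y x < d \<Longrightarrow> dist (f y) (f x) < f x - q"
    using f(1) x q(3) unfolding continuous_on_iff by (metis ComplI diff_gt_0_iff_gt singletonD)
  \<comment> \<open>This slope brings the cone below 0 at distance \<open>d / 2\<close> from its
    apex.\<close>
  obtain p where p: "p \<in> \<rat>" "2 * q / d < p"
    using Rats_dense_in_real[of "2 * q / d" "2 * q / d + 1"] by auto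
  have p0: "p > 0"
    using p(2) q b(1) d(1) by (smt (verit) divide_pos_pos)
  \<comment> \<open>The first bound keeps points at distance \<open>d\<close> from \<open>x\<close>
    at distance \<open>d / 2\<close> from the apex; the second keeps the cone above \<open>b\<close>
    at \<open>x\<close>.\<close>
  define r where "r = min (d / 2) ((q - b) / p)"
  have "r > 0"
    using d q p0 by (simp add: r_def)
  then obtain a where a: "a \<in> D" "dist x a < r"
    using D[of "ball x r"] by auto
  show ?thesis
  proof (rule that[OF a(1) p(1) q(1)])
    have "norm (x - a) < (q - b) / p"
      using a(2) by (simp add: dist_norm r_def)
    then show "b < q - p * norm (x - a)"
      using p0 by (simp add: field_simps)
    fix y :: "real^3" assume y: "y \<noteq> 0"
    show "q - p * norm (y - a) \<le> f y"
    proof (cases "dist y x < d")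
      case True
      then have "q < f y"
        using d(2)[OF y True] by (simp add: dist_real_def abs_less_iff)
      then show ?thesis
        using p0 by (smt (verit) mult_nonneg_nonneg norm_ge_zero)
    next
      case False
      then have "d / 2 \<le> norm (y - a)"
        using a(2) dist_triangle[of y x a] by (simp add: r_def dist_norm norm_minus_commute)
      then have "p * (d / 2) \<le> p * norm (y - a)"
        using p0 by simp
      moreover have "q < p * (d / 2)"
        using p(2) d(1) by (simp add: field_simps)
      ultimately show ?thesis
        using f(2)[OF y] by simp
    qed
  qed
qed

text \<open>Enumerate the cones below \<open>f\<close> with data from \<open>D\<close> and the
  rationals. By \<open>cone_below\<close> the maxima of the first \<open>n\<close> tend pointwise to
  \<open>f\<close> off the origin, and \<open>f\<close> itself dominates them, so their pairings
  converge.\<close>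

lemma pairing_cone_max_approx:
  assumes f: "f \<in> compact_support_pos" and \<mu>: "radon_measure \<mu>"
    and D: "countable D" "\<And>U. open U \<Longrightarrow> U \<noteq> {} \<Longrightarrow> \<exists>d\<in>D. d \<in> U"
    and a: "a < pairing \<mu> f"
  obtains L where "L \<in> lists (D \<times> \<rat> \<times> \<rat>)" "cone_max L \<in> compact_support_pos"
    "\<forall>x\<in>punctured. cone_max L x \<le> f x" "a < pairing \<mu> (cone_max L)"
proof -
  have fc: "f \<in> compact_support_fun" "continuous_on punctured f" and f0: "\<And>x. x \<noteq> 0 \<Longrightarrow> 0 \<le> f x"
    using f by (auto simp: compact_support_pos_def compact_support_fun_def)
  define J where "J = {(c, p, q) \<in> D \<times> \<rat> \<times> \<rat>. \<forall>x. x \<noteq> 0 \<longrightarrow> q - p * norm (x - c) \<le> f x}"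
  have "countable J"
    using D(1) countable_rat unfolding J_def
    by (intro countable_subset[OF _ countable_SIGMA[OF D(1) countable_SIGMA[OF countable_rat countable_rat]]])
      auto
  \<comment> \<open>The zero cone \<open>(c, 0, 0)\<close> is a member, so
    \<open>from_nat_into\<close> enumerates exactly \<open>J\<close>.\<close>
  moreover have "J \<noteq> {}"
  proof -
    obtain c where "c \<in> D"
      using D(2)[of UNIV] by auto
    then have "(c, 0, 0) \<in> J"
      using f0 by (auto simp: J_def)
    then show ?thesis by auto
  qed
  ultimately have e: "range (from_nat_into J) = J"
    by (rule range_from_nat_into[rotated])
  define L where "L n = map (from_nat_into J) [0..<n]" for n
  have sL: "set (L n) \<subseteq> J" for n
    using e by (auto simp: L_def)
  have below: "cone_max (L n) x \<le> f x" if "x \<noteq> 0" for n x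
    unfolding cone_max_le_iff using f0[OF that] sL[of n] that by (auto simp: J_def)
  have cc: "cone_max (L n) \<in> compact_support_fun" for n
    using below by (intro compact_support_fun_dominated[OF fc(1) continuous_on_cone_max])
      (simp add: cone_max_nonneg)
  have lim: "(\<lambda>n. cone_max (L n) x) \<longlonglongrightarrow> f x" if x: "x \<noteq> 0" for x
  proof (rule order_tendstoI)
    fix y assume "y < f x"
    show "\<forall>\<^sub>F n in sequentially. y < cone_max (L n) x"
    \<comment> \<open>\<open>cone_below\<close> takes a nonnegative bound; for negative
      \<open>y\<close> the maxima are above it anyway.\<close>
    proof (cases "y < 0")
      case True
      then show ?thesis
        by (intro always_eventually allI less_le_trans[OF True cone_max_nonneg])
    next
      case False
      then obtain c p q where cpq: "c \<in> D" "p \<in> \<rat>" "q \<in> \<rat>" "y < q - p * norm (x - c)"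
        "\<And>z. z \<noteq> 0 \<Longrightarrow> q - p * norm (z - c) \<le> f z"
        using cone_below[OF fc(2) f0 D(2) x, of y] \<open>y < f x\<close> by (metis not_less)
      then have "(c, p, q) \<in> J"
        by (auto simp: J_def)
      then obtain m where m: "from_nat_into J m = (c, p, q)"
        using e by (metis imageE)
      have "y < cone_max (L n) x" if "n > m" for n
      proof -
        have "(c, p, q) \<in> set (L n)"
          using that m[symmetric] by (auto simp: L_def)
        from cone_max_ge[OF this, of x] cpq(4) show ?thesis by simp
      qed
      then show ?thesis
        using eventually_gt_at_top[of m] by (rule eventually_mono[rotated])
    qed
  next
    fix y assume "f x < y"
    then show "\<forall>\<^sub>F n in sequentially. cone_max (L n) x < y"
      by (intro always_eventually allI le_less_trans[OF below[OF x]])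
  qed
  have "(\<lambda>n. pairing \<mu> (cone_max (L n))) \<longlonglongrightarrow> pairing \<mu> f"
    unfolding pairing_def
  proof (rule integral_dominated_convergence[where w=f])
    show "f \<in> borel_measurable \<mu>" "\<And>n. cone_max (L n) \<in> borel_measurable \<mu>" "integrable \<mu> f"
      using integrable_compact_support_fun[OF \<mu>] fc(1) cc by (auto dest: borel_measurable_integrable)
    show "AE x in \<mu>. (\<lambda>n. cone_max (L n) x) \<longlonglongrightarrow> f x"
      using lim by (intro AE_I2) (auto simp: radon_measure_space[OF \<mu>])
    show "AE x in \<mu>. norm (cone_max (L n) x) \<le> f x" for n
      using below cone_max_nonneg by (intro AE_I2) (auto simp: radon_measure_space[OF \<mu>])
  qed
  then obtain n where "a < pairing \<mu> (cone_max (L n))"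
    using order_tendstoD(1)[OF _ a] eventually_happens by (metis sequentially_bot)
  moreover have "L n \<in> lists (D \<times> \<rat> \<times> \<rat>)"
    using sL[of n] by (auto simp: J_def)
  ultimately show ?thesis
    using cc[of n] below[of _ n] cone_max_nonneg by (intro that[of "L n"]) (auto simp: compact_support_pos_def)
qed

section \<open>Countably many dominating functions and vague half-spaces\<close>

definition shell :: "nat \<Rightarrow> real^3 \<Rightarrow> real"
  where "shell n x = max 0 (min (n * norm x - 1) (n - norm x))"

lemma shell_compact_support_pos: "shell n \<in> compact_support_pos"
proof -
  let ?K = "cball (0::real^3) (real n) - ball 0 (1 / real n)"
  have "shell n x = 0" if "x \<in> punctured - ?K" for x
  proof -
    have "norm x > n \<or> norm x < 1 / real n"
      using that by auto
    then show ?thesis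
      by (cases "n = 0") (auto simp: shell_def field_simps)
  qed
  moreover have "compact ?K"
    by (intro compact_diff compact_cball open_ball)
  moreover have "\<exists>K. compact K \<and> K \<subseteq> punctured \<and> (\<forall>x\<in>punctured - K. shell n x = 0)"
  proof (cases "n = 0")
    \<comment> \<open>Since \<open>1 / 0 = 0\<close>, the set \<open>?K\<close> is here the origin
      alone. But \<open>shell 0\<close> vanishes identically, so the empty set serves as
      support.\<close>
    case True
    then show ?thesis
      by (intro exI[of _ "{}"]) (auto simp: shell_def)
  next
    case False
    then have "?K \<subseteq> punctured"
      by auto
    with calculation show ?thesis
      by blast
  qed
  moreover have "continuous_on punctured (shell n)"
    unfolding shell_def by (intro continuous_intros)
  ultimately show ?thesis
    by (auto simp: compact_support_pos_def compact_support_fun_def shell_def)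
qed

text \<open>A shell that is at least 1 on the support, times an integer above the bound of
  \<open>f\<close>, dominates \<open>f\<close>. Thus a countable family dominates all compactly
  supported functions.\<close>

lemma compact_support_fun_le_shell:
  assumes "f \<in> compact_support_fun"
  obtains m n :: nat where "\<And>x. x \<noteq> 0 \<Longrightarrow> \<bar>f x\<bar> \<le> m * shell n x"
proof -
  obtain K B where KB: "compact K" "K \<subseteq> punctured" "B > 0"
    "\<And>x. x \<noteq> 0 \<Longrightarrow> \<bar>f x\<bar> \<le> B * indicator K x"
    using compact_support_fun_bound[OF assms] by metis
  obtain d where d: "d > 0" "\<And>x. x \<in> K \<Longrightarrow> d \<le> norm x"
    using separate_point_closed[OF compact_imp_closed[OF KB(1)], of 0] KB(2) by auto
  obtain R where R: "\<And>x. x \<in> K \<Longrightarrow> norm x \<le> R"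
    using compact_imp_bounded[OF KB(1)] unfolding bounded_iff by auto
  obtain m where m: "B \<le> real m"
    using real_arch_simple by blast
  \<comment> \<open>The two lower bounds on \<open>n\<close> make \<open>n * norm x - 1\<close> and
    \<open>n - norm x\<close> at least 1 on \<open>K\<close>.\<close>
  obtain n where n: "max (2 / d) (R + 1) \<le> real n"
    using real_arch_simple by blast
  have "\<bar>f x\<bar> \<le> m * shell n x" if x: "x \<noteq> 0" for x
  proof (cases "x \<in> K")
    case True
    have "2 \<le> real n * d"
      using n d(1) by (simp add: field_simps)
    also have "\<dots> \<le> real n * norm x"
      using d(2)[OF True] by (intro mult_left_mono) auto
    finally have "1 \<le> shell n x"
      using n R[OF True] by (simp add: shell_def)
    then have "B * 1 \<le> real m * shell n x"
      using m KB(3) by (intro mult_mono) auto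
    then show ?thesis
      using KB(4)[OF x] True by simp
  next
    case False
    then show ?thesis
      using KB(4)[OF x] by (simp add: shell_def)
  qed
  then show ?thesis
    by (rule that)
qed

text \<open>A compactly supported \<open>f\<close> need not be nonnegative, so lower semicontinuity of
  \<open>\<mu> \<mapsto> \<langle>\<mu>, f\<rangle>\<close> is obtained for \<open>f + h\<close> with \<open>h\<close> a multiple of a shell function above \<open>\<bar>f\<bar>\<close>, while
  \<open>\<langle>\<mu>, h\<rangle>\<close> is controlled by a second half-space.\<close>

lemma vague_half_space_nbhd:
  obtains E :: "(real^3 \<Rightarrow> real) set" where "countable E" "E \<subseteq> compact_support_pos"
    "\<And>f \<mu>\<^sub>0 a. f \<in> compact_support_fun \<Longrightarrow> radon_measure \<mu>\<^sub>0 \<Longrightarrow> a < pairing \<mu>\<^sub>0 f \<Longrightarrow>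
      \<exists>g\<in>E. \<exists>h\<in>E. \<exists>r\<in>\<rat>. \<exists>s\<in>\<rat>. r < pairing \<mu>\<^sub>0 g \<and> pairing \<mu>\<^sub>0 h < s \<and>
        (\<forall>\<mu>. radon_measure \<mu> \<longrightarrow> r < pairing \<mu> g \<longrightarrow> pairing \<mu> h < s \<longrightarrow> a < pairing \<mu> f)"
proof -
  obtain D :: "(real^3) set" where D: "countable D" "\<And>U. open U \<Longrightarrow> U \<noteq> {} \<Longrightarrow> \<exists>d\<in>D. d \<in> U"
    using countable_dense_setE by blast
  define E where "E = (cone_max ` lists (D \<times> \<rat> \<times> \<rat>) \<inter> compact_support_pos)
    \<union> range (\<lambda>(m, n). \<lambda>x. real m * shell n x)"
  show ?thesis
  proof (rule that)
    have "countable (lists (D \<times> (\<rat>::real set) \<times> (\<rat>::real set)))"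
      by (intro countable_lists countable_SIGMA D countable_rat)
    then show "countable E"
      unfolding E_def by (intro countable_Un countable_image countable_Int1) auto
    show "E \<subseteq> compact_support_pos"
      using compact_support_pos_scale[OF shell_compact_support_pos, of 1] by (auto simp: E_def)
    fix f \<mu>\<^sub>0 a
    assume f: "f \<in> compact_support_fun" and \<mu>\<^sub>0: "radon_measure \<mu>\<^sub>0" and a: "a < pairing \<mu>\<^sub>0 f"
    obtain m n where mn: "\<And>x. x \<noteq> 0 \<Longrightarrow> \<bar>f x\<bar> \<le> real m * shell n x"
      using compact_support_fun_le_shell[OF f] by metis
    define h where "h x = real m * shell n x" for x
    have h: "h \<in> E" "h \<in> compact_support_fun"
      unfolding h_def[abs_def] E_def
      using compact_support_fun_cmult[OF compact_support_posD[OF shell_compact_support_pos]] by auto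
    have fh: "(\<lambda>x. f x + h x) \<in> compact_support_fun"
      using f h by (intro compact_support_fun_add)
    moreover have "0 \<le> f x + h x" if "x \<noteq> 0" for x
      using mn[OF that] by (simp add: h_def)
    ultimately have fhp: "(\<lambda>x. f x + h x) \<in> compact_support_pos"
      by (auto simp: compact_support_pos_def)
    have lt: "a + pairing \<mu>\<^sub>0 h < pairing \<mu>\<^sub>0 (\<lambda>x. f x + h x)"
      using a by (simp add: pairing_add[OF \<mu>\<^sub>0 f h(2)])
    obtain L where L: "L \<in> lists (D \<times> \<rat> \<times> \<rat>)" "cone_max L \<in> compact_support_pos"
      "\<forall>x\<in>punctured. cone_max L x \<le> f x + h x" "a + pairing \<mu>\<^sub>0 h < pairing \<mu>\<^sub>0 (cone_max L)"
      by (rule pairing_cone_max_approx[OF fhp \<mu>\<^sub>0 D lt]) blast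
    \<comment> \<open>The thresholds satisfy \<open>r - s > a\<close>. Since
      \<open>cone_max L\<close> lies below \<open>f + h\<close>, the two half-space conditions give
      \<open>pairing \<mu> f > r - s\<close>.\<close>
    obtain s where s: "s \<in> \<rat>" "pairing \<mu>\<^sub>0 h < s" "s < pairing \<mu>\<^sub>0 (cone_max L) - a"
      using Rats_dense_in_real[of "pairing \<mu>\<^sub>0 h" "pairing \<mu>\<^sub>0 (cone_max L) - a"] L(4) by auto
    obtain r where r: "r \<in> \<rat>" "a + s < r" "r < pairing \<mu>\<^sub>0 (cone_max L)"
      using Rats_dense_in_real[of "a + s" "pairing \<mu>\<^sub>0 (cone_max L)"] s(3) by auto
    have "a < pairing \<mu> f" if \<mu>: "radon_measure \<mu>" and "r < pairing \<mu> (cone_max L)" "pairing \<mu> h < s" for \<mu>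
      using pairing_mono[OF \<mu> compact_support_posD[OF L(2)] fh] L(3) that r
      by (simp add: pairing_add[OF \<mu> f h(2)])
    moreover have "cone_max L \<in> E"
      using L by (auto simp: E_def)
    ultimately show "\<exists>g\<in>E. \<exists>h\<in>E. \<exists>r\<in>\<rat>. \<exists>s\<in>\<rat>. r < pairing \<mu>\<^sub>0 g \<and> pairing \<mu>\<^sub>0 h < s \<and>
        (\<forall>\<mu>. radon_measure \<mu> \<longrightarrow> r < pairing \<mu> g \<longrightarrow> pairing \<mu> h < s \<longrightarrow> a < pairing \<mu> f)"
      using h(1) r(1,3) s(1,2)
      by (intro bexI[of _ "cone_max L"] bexI[of _ h] bexI[of _ r] bexI[of _ s] conjI allI impI)
  qed
qed

text \<open>Lists encode finite intersections of half-spaces: appending lists intersects boxes, and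
  the empty list gives the whole state set.\<close>

definition lower_box :: "real \<Rightarrow> ((real^3 \<Rightarrow> real) \<times> real) list \<Rightarrow> (real^3) measure set"
  where "lower_box \<rho> L = {\<mu>\<in>state_set \<rho>. \<forall>(f, a)\<in>set L. pairing \<mu> f < a}"

text \<open>Boxes are Borel because pairings are measurable. Conversely, a countable family
  \<open>W\<close> of sets measurable for the boxes supplies neighbourhoods inside every subbasic
  set, so every vaguely open set is generated by \<open>W\<close>.\<close>

lemma sets_state_space_lower_box:
  "sets (state_space \<rho>) = sigma_sets (state_set \<rho>) (lower_box \<rho> ` lists (compact_support_pos \<times> UNIV))"
  (is "_ = sigma_sets ?S ?G")
proof
  have "lower_box \<rho> L \<in> sets (state_space \<rho>)" if "L \<in> lists (compact_support_pos \<times> UNIV)" for L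
    using that
  proof (induction L)
    case Nil
    then show ?case
      using sets.top[of "state_space \<rho>"] by (simp add: lower_box_def space_state_space)
  next
    case (Cons i L)
    obtain f a where i: "i = (f, a)" "f \<in> compact_support_pos"
      using Cons by auto
    have "{\<mu>\<in>space (state_space \<rho>). pairing \<mu> f < a} \<in> sets (state_space \<rho>)"
      using measurable_pairing[OF compact_support_posD[OF i(2)]] by measurable
    then have "{\<mu>\<in>space (state_space \<rho>). pairing \<mu> f < a} \<inter> lower_box \<rho> L \<in> sets (state_space \<rho>)"
      using Cons by auto
    also have "{\<mu>\<in>space (state_space \<rho>). pairing \<mu> f < a} \<inter> lower_box \<rho> L = lower_box \<rho> (i # L)"
      by (auto simp: lower_box_def i space_state_space)
    finally show ?case .
  qed
  then show "sigma_sets ?S ?G \<subseteq> sets (state_space \<rho>)"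
    using sets.sigma_sets_subset[of ?G "state_space \<rho>"] by (auto simp: space_state_space)
next
  define M where "M = sigma ?S ?G"
  have GP: "?G \<subseteq> Pow ?S"
    by (auto simp: lower_box_def)
  have M: "space M = ?S" "sets M = sigma_sets ?S ?G"
    using GP by (simp_all add: M_def)
  have meas: "(\<lambda>\<mu>. pairing \<mu> f) \<in> borel_measurable M" if "f \<in> compact_support_pos" for f
  proof (subst borel_measurable_iff_less, intro allI)
    fix a
    have "lower_box \<rho> [(f, a)] \<in> sets M"
      using that by (auto simp: M intro!: sigma_sets.Basic)
    then show "{\<mu> \<in> space M. pairing \<mu> f < a} \<in> sets M"
      by (simp add: M lower_box_def)
  qed
  obtain E :: "(real^3 \<Rightarrow> real) set" where E: "countable E" "E \<subseteq> compact_support_pos"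
    and nbhd: "\<And>f \<mu>\<^sub>0 a. f \<in> compact_support_fun \<Longrightarrow> radon_measure \<mu>\<^sub>0 \<Longrightarrow> a < pairing \<mu>\<^sub>0 f \<Longrightarrow>
      \<exists>g\<in>E. \<exists>h\<in>E. \<exists>r\<in>\<rat>. \<exists>s\<in>\<rat>. r < pairing \<mu>\<^sub>0 g \<and> pairing \<mu>\<^sub>0 h < s \<and>
        (\<forall>\<mu>. radon_measure \<mu> \<longrightarrow> r < pairing \<mu> g \<longrightarrow> pairing \<mu> h < s \<longrightarrow> a < pairing \<mu> f)"
    by (rule vague_half_space_nbhd) blast
  define W where "W = (\<lambda>(g, h, r, s). {\<mu>\<in>?S. r < pairing \<mu> g \<and> pairing \<mu> h < s}) `
    (E \<times> E \<times> \<rat> \<times> \<rat>)"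
  have W: "countable W" "W \<subseteq> Pow ?S"
    unfolding W_def by (auto intro!: countable_image countable_SIGMA E countable_rat)
  have "W \<subseteq> sets M"
  proof
    fix w assume "w \<in> W"
    then obtain g h r s where gh: "g \<in> E" "h \<in> E"
      and w: "w = {\<mu>\<in>space M. r < pairing \<mu> g \<and> pairing \<mu> h < s}"
      by (auto simp: W_def M)
    have [measurable]: "(\<lambda>\<mu>. pairing \<mu> g) \<in> borel_measurable M" "(\<lambda>\<mu>. pairing \<mu> h) \<in> borel_measurable M"
      using meas gh E(2) by auto
    show "w \<in> sets M"
      unfolding w by measurable
  qed
  then have "sigma_sets ?S W \<subseteq> sets M"
    using sets.sigma_sets_subset[of W M] by (simp add: M)
  have one: "\<exists>w\<in>W. \<mu>\<^sub>0 \<in> w \<and> (\<forall>\<mu>\<in>w. a < pairing \<mu> f)"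
    if f: "f \<in> compact_support_fun" and \<mu>\<^sub>0: "\<mu>\<^sub>0 \<in> ?S" and a: "a < pairing \<mu>\<^sub>0 f" for f \<mu>\<^sub>0 a
  proof -
    obtain g h r s where "g \<in> E" "h \<in> E" "r \<in> \<rat>" "s \<in> \<rat>" "r < pairing \<mu>\<^sub>0 g" "pairing \<mu>\<^sub>0 h < s"
      "\<And>\<mu>. radon_measure \<mu> \<Longrightarrow> r < pairing \<mu> g \<Longrightarrow> pairing \<mu> h < s \<Longrightarrow> a < pairing \<mu> f"
      using nbhd[OF f _ a] \<mu>\<^sub>0 unfolding state_set_def by blast
    then show ?thesis
      using \<mu>\<^sub>0 unfolding W_def
      by (intro bexI[of _ "{\<mu>\<in>?S. r < pairing \<mu> g \<and> pairing \<mu> h < s}"])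
        (auto simp: state_set_def image_iff)
  qed
  have "U \<in> sigma_sets ?S W" if "openin (vague_topology \<rho>) U" for U
  proof (rule generated_topology_subset_sigma_sets[OF W])
    show "generate_topology_on {{\<mu>\<in>?S. pairing \<mu> f \<in> U} | f U. f \<in> compact_support_fun \<and> open U} U"
      using that unfolding vague_topology_def by (rule openin_topology_generated_by)
    fix B \<mu>\<^sub>0
    assume "B \<in> {{\<mu>\<in>?S. pairing \<mu> f \<in> U} | f U. f \<in> compact_support_fun \<and> open U}" "\<mu>\<^sub>0 \<in> B"
    then obtain f V where f: "f \<in> compact_support_fun" and V: "open V" "pairing \<mu>\<^sub>0 f \<in> V"
      and B: "B = {\<mu>\<in>?S. pairing \<mu> f \<in> V}" and \<mu>\<^sub>0: "\<mu>\<^sub>0 \<in> ?S"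
      by auto
    obtain e where e: "e > 0" "\<And>y. dist y (pairing \<mu>\<^sub>0 f) < e \<Longrightarrow> y \<in> V"
      using V unfolding open_dist by blast
    obtain w where w: "w \<in> W" "\<mu>\<^sub>0 \<in> w" "\<And>\<mu>. \<mu> \<in> w \<Longrightarrow> pairing \<mu>\<^sub>0 f - e < pairing \<mu> f"
      using one[OF f \<mu>\<^sub>0, of "pairing \<mu>\<^sub>0 f - e"] e(1) by auto
    \<comment> \<open>Applying the lower estimate to \<open>- f\<close> gives the upper one;
      together they confine the pairing to an interval inside \<open>V\<close>.\<close>
    obtain w' where w': "w' \<in> W" "\<mu>\<^sub>0 \<in> w'" "\<And>\<mu>. \<mu> \<in> w' \<Longrightarrow> pairing \<mu> f < pairing \<mu>\<^sub>0 f + e"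
      using one[OF compact_support_fun_uminus[OF f] \<mu>\<^sub>0, of "- pairing \<mu>\<^sub>0 f - e"] e(1)
      unfolding pairing_uminus by fastforce
    have "?S \<inter> \<Inter>{w, w'} \<subseteq> B"
    proof
      fix \<mu> assume "\<mu> \<in> ?S \<inter> \<Inter>{w, w'}"
      then show "\<mu> \<in> B"
        using w(3)[of \<mu>] w'(3)[of \<mu>] e(2)[of "pairing \<mu> f"] by (auto simp: B dist_real_def)
    qed
    then show "\<exists>ws. finite ws \<and> ws \<subseteq> W \<and> \<mu>\<^sub>0 \<in> ?S \<inter> \<Inter>ws \<and> ?S \<inter> \<Inter>ws \<subseteq> B"
      using w(1,2) w'(1,2) \<mu>\<^sub>0 by (intro exI[of _ "{w, w'}"]) auto
  qed
  with \<open>sigma_sets ?S W \<subseteq> sets M\<close> have "{U. openin (vague_topology \<rho>) U} \<subseteq> sets M"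
    by blast
  then show "sets (state_space \<rho>) \<subseteq> sigma_sets ?S ?G"
    using sets.sigma_sets_subset[of _ M] by (simp add: sets_state_space M)
qed

subsection \<open>Laplace functionals determine the law of a random measure\<close>

text \<open>Ramps of slope \<open>n\<close> starting at \<open>c\<close> tend to the indicator of
  the open half-line, with value 0 at \<open>c\<close> itself. Weierstrass approximation on the unit
  interval with error \<open>1 / (1 + n)\<close> preserves the limit and the bound 2.\<close>

lemma polynomial_approx_half_line:
  fixes c :: real
  obtains p :: "nat \<Rightarrow> real \<Rightarrow> real" where "\<And>n. real_polynomial_function (p n)"
    "\<And>n y. y \<in> {0..1} \<Longrightarrow> \<bar>p n y\<bar> \<le> 2"
    "\<And>y. y \<in> {0..1} \<Longrightarrow> (\<lambda>n. p n y) \<longlonglongrightarrow> indicator {c<..} y"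
proof -
  define g where "g n y = min 1 (max 0 (real n * (y - c)))" for n y
  have "\<exists>q. real_polynomial_function q \<and> (\<forall>y\<in>{0..1}. \<bar>g n y - q y\<bar> < 1 / (1 + real n))" for n
    by (rule Stone_Weierstrass_real_polynomial_function[of "{0..1::real}" "g n" "1 / (1 + real n)"])
      (auto simp: g_def intro!: continuous_intros)
  then obtain p where p: "\<And>n. real_polynomial_function (p n)"
    "\<And>n y. y \<in> {0..1} \<Longrightarrow> \<bar>g n y - p n y\<bar> < 1 / (1 + real n)"
    by metis
  show ?thesis
  proof (rule that[of p, OF p(1)])
    fix n and y :: real assume y: "y \<in> {0..1}"
    have "1 / (1 + real n) \<le> 1" "\<bar>g n y\<bar> \<le> 1"
      by (auto simp: g_def)
    then show "\<bar>p n y\<bar> \<le> 2"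
      using p(2)[OF y, of n] by linarith
  next
    fix y :: real assume y: "y \<in> {0..1}"
    have "(\<lambda>n. 1 / (1 + real n)) \<longlonglongrightarrow> 0"
      by real_asymp
    then have "(\<lambda>n. g n y - p n y) \<longlonglongrightarrow> 0"
      by (rule Lim_null_comparison[rotated])
        (intro always_eventually allI, use p(2)[OF y] in \<open>auto intro: less_imp_le\<close>)
    moreover have "(\<lambda>n. g n y) \<longlonglongrightarrow> indicator {c<..} y"
    proof (cases "y > c")
      case True
      obtain N :: nat where N: "1 / (y - c) \<le> N"
        using real_arch_simple by blast
      have "g n y = 1" if "n \<ge> N" for n
      proof -
        have "1 / (y - c) \<le> real n"
          using N that by linarith
        then show ?thesis
          using True by (simp add: g_def field_simps)
      qed
      then have "\<forall>\<^sub>F n in sequentially. g n y = 1"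
        unfolding eventually_sequentially by blast
      then show ?thesis
        using True by (simp add: tendsto_eventually)
    next
      case False
      then have "g n y = 0" for n
        by (simp add: g_def mult_nonneg_nonpos)
      then show ?thesis
        using False by simp
    qed
    ultimately show "(\<lambda>n. p n y) \<longlonglongrightarrow> indicator {c<..} y"
      using tendsto_diff[of "\<lambda>n. g n y" _ sequentially "\<lambda>n. g n y - p n y" 0] by simp
  qed
qed

text \<open>Equal moments give equal integrals of polynomials in \<open>Y\<close>, and dominated
  convergence passes to the indicator. The bounded weight \<open>G\<close> carries the half-spaces
  already treated.\<close>

lemma moments_determine_half_line_integral:
  fixes Y G :: "'a \<Rightarrow> real"
  assumes M: "finite_measure M" and N: "finite_measure N" and sets: "sets M = sets N"
    and [measurable]: "Y \<in> borel_measurable M" "G \<in> borel_measurable M"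
    and Y: "\<And>x. x \<in> space M \<Longrightarrow> Y x \<in> {0..1}"
    and G: "\<And>x. x \<in> space M \<Longrightarrow> \<bar>G x\<bar> \<le> 1"
    and eq: "\<And>i::nat. (LINT x|M. Y x ^ i * G x) = (LINT x|N. Y x ^ i * G x)"
  shows "(LINT x|M. indicator {c<..} (Y x) * G x) = (LINT x|N. indicator {c<..} (Y x) * G x)"
proof -
  have [measurable]: "Y \<in> borel_measurable N" "G \<in> borel_measurable N"
    unfolding measurable_cong_sets[OF sets[symmetric] refl] by measurable
  obtain p :: "nat \<Rightarrow> real \<Rightarrow> real" where p: "\<And>n. real_polynomial_function (p n)"
    "\<And>n y. y \<in> {0..1} \<Longrightarrow> \<bar>p n y\<bar> \<le> 2"
    "\<And>y. y \<in> {0..1} \<Longrightarrow> (\<lambda>n. p n y) \<longlonglongrightarrow> indicator {c<..} y"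
    using polynomial_approx_half_line[of c] by metis
  have pm: "p n \<in> borel_measurable borel" for n
    using p(1)[of n] by (intro borel_measurable_continuous_onI) (simp add: continuous_on_polymonial_function real_polynomial_function_eq)
  have poly: "(LINT x|M. p n (Y x) * G x) = (LINT x|N. p n (Y x) * G x)" for n
  proof -
    obtain a m where pn: "p n = (\<lambda>y. \<Sum>i\<le>m. a i * y ^ i)"
      using p(1)[of n] unfolding real_polynomial_function_iff_sum by metis
    have int: "integrable Q (\<lambda>x. Y x ^ i * G x)" if "finite_measure Q" "sets Q = sets M" for Q i
    proof (rule finite_measure.integrable_const_bound[OF that(1), of _ 1])
      have "space Q = space M"
        using that(2) by (rule sets_eq_imp_space_eq)
      then show "AE x in Q. norm (Y x ^ i * G x) \<le> 1"
        using Y G by (intro AE_I2) (auto simp: abs_mult power_abs intro!: mult_le_one power_le_one)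
      show "(\<lambda>x. Y x ^ i * G x) \<in> borel_measurable Q"
        unfolding measurable_cong_sets[OF that(2) refl] by measurable
    qed
    have "(LINT x|Q. p n (Y x) * G x) = (\<Sum>i\<le>m. a i * (LINT x|Q. Y x ^ i * G x))"
      if "finite_measure Q" "sets Q = sets M" for Q
      using int[OF that] by (simp add: pn sum_distrib_right mult.assoc)
    then show ?thesis
      using M N sets eq by simp
  qed
  have lim: "(\<lambda>n. LINT x|Q. p n (Y x) * G x) \<longlonglongrightarrow> (LINT x|Q. indicator {c<..} (Y x) * G x)"
    if Q: "finite_measure Q" "sets Q = sets M" for Q
  proof (rule integral_dominated_convergence[where w="\<lambda>_. 2"])
    interpret finite_measure Q by fact
    have sQ: "space Q = space M"
      using Q(2) by (rule sets_eq_imp_space_eq)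
    show "integrable Q (\<lambda>_. 2::real)"
      by simp
    show "(\<lambda>x. indicator {c<..} (Y x) * G x) \<in> borel_measurable Q"
      unfolding measurable_cong_sets[OF Q(2) refl] by measurable
    show "(\<lambda>x. p n (Y x) * G x) \<in> borel_measurable Q" for n
      unfolding measurable_cong_sets[OF Q(2) refl] using pm[of n] by measurable
    show "AE x in Q. (\<lambda>n. p n (Y x) * G x) \<longlonglongrightarrow> indicator {c<..} (Y x) * G x"
      using p(3) Y by (intro AE_I2 tendsto_mult_right) (auto simp: sQ)
    have "\<bar>p n y\<bar> * \<bar>z\<bar> \<le> 2 * 1" if "y \<in> {0..1}" "\<bar>z\<bar> \<le> 1" for n y z
      using p(2)[OF that(1)] that(2) by (intro mult_mono) auto
    then show "AE x in Q. norm (p n (Y x) * G x) \<le> 2" for n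
      using Y G by (intro AE_I2) (simp add: sQ abs_mult)
  qed
  show ?thesis
    by (rule LIMSEQ_unique[OF lim[OF M refl, unfolded poly] lim[OF N sets[symmetric]]])
qed

text \<open>Positivity is what allows equality of Laplace functionals to be concluded from equality
  of their logarithms.\<close>

lemma integral_exp_pairing_pos:
  assumes "prob_space Q" "sets Q = sets (state_space \<rho>)" and f: "f \<in> compact_support_pos"
  shows "0 < (LINT \<mu>|Q. exp (- pairing \<mu> f))"
proof -
  interpret prob_space Q by fact
  have sQ: "space Q = state_set \<rho>"
    using sets_eq_imp_space_eq[OF assms(2)] by (simp add: space_state_space)
  have "(\<lambda>\<mu>. exp (- pairing \<mu> f)) \<in> borel_measurable Q"
    using measurable_pairing[OF compact_support_posD[OF f], of \<rho>]
    unfolding measurable_cong_sets[OF assms(2) refl] by measurable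
  then have "integrable Q (\<lambda>\<mu>. exp (- pairing \<mu> f))"
    using pairing_nonneg[OF _ f]
    by (intro integrable_const_bound[of _ 1] AE_I2) (auto simp: sQ state_set_def)
  then have "(LINT \<mu>|Q. 0) < (LINT \<mu>|Q. exp (- pairing \<mu> f))"
    by (intro integral_less_AE_space) (auto simp: emeasure_space_1)
  then show ?thesis
    by simp
qed

text \<open>Half-spaces are inserted one at a time into the Laplace functional, with the exponent
  \<open>f\<close> left arbitrary; taking \<open>f = 0\<close> at the end gives the probabilities of
  the boxes, a generating system closed under intersection.\<close>

lemma laplace_functional_unique:
  assumes Q: "prob_space Q" "sets Q = sets (state_space \<rho>)"
    and R: "prob_space R" "sets R = sets (state_space \<rho>)"
    and eq: "\<And>f. f \<in> compact_support_pos \<Longrightarrow>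
      (LINT \<mu>|Q. exp (- pairing \<mu> f)) = (LINT \<mu>|R. exp (- pairing \<mu> f))"
  shows "Q = R"
proof -
  interpret Q: prob_space Q by fact
  interpret R: prob_space R by fact
  have sQ: "space Q = state_set \<rho>" and sR: "space R = state_set \<rho>"
    using sets_eq_imp_space_eq[OF Q(2)] sets_eq_imp_space_eq[OF R(2)] by (simp_all add: space_state_space)
  have box: "lower_box \<rho> L \<in> sets (state_space \<rho>)" if "L \<in> lists (compact_support_pos \<times> UNIV)" for L
    unfolding sets_state_space_lower_box using that by auto
  have meas: "(\<lambda>\<mu>. exp (- pairing \<mu> f)) \<in> borel_measurable (state_space \<rho>)"
    if "f \<in> compact_support_pos" for f
    using measurable_pairing[OF compact_support_posD[OF that], of \<rho>] by measurable
  have le1: "\<bar>exp (- pairing \<mu> f)\<bar> \<le> 1" if "\<mu> \<in> state_set \<rho>" "f \<in> compact_support_pos" for \<mu> f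
    using pairing_nonneg[of \<mu> f] that by (simp add: state_set_def)
  have key: "(LINT \<mu>|Q. exp (- pairing \<mu> f) * indicator (lower_box \<rho> L) \<mu>)
      = (LINT \<mu>|R. exp (- pairing \<mu> f) * indicator (lower_box \<rho> L) \<mu>)"
    if "L \<in> lists (compact_support_pos \<times> UNIV)" "f \<in> compact_support_pos" for L f
    using that
  proof (induction L arbitrary: f rule: list.induct)
    case Nil
    have "(LINT \<mu>|P. exp (- pairing \<mu> f) * indicator (lower_box \<rho> []) \<mu>) = (LINT \<mu>|P. exp (- pairing \<mu> f))"
      if "space P = state_set \<rho>" for P
      using that by (intro Bochner_Integration.integral_cong) (auto simp: lower_box_def)
    then show ?case
      using eq[OF Nil(2)] sQ sR by simp
  next
    case (Cons i L)
    obtain g a where i: "i = (g, a)" and g: "g \<in> compact_support_pos"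
      and L: "L \<in> lists (compact_support_pos \<times> UNIV)"
      using Cons.prems(1) by auto
    note f = Cons.prems(2)
    define G where "G \<mu> = exp (- pairing \<mu> f) * indicator (lower_box \<rho> L) \<mu>" for \<mu>
    have G: "G \<in> borel_measurable (state_space \<rho>)"
      unfolding G_def using meas[OF f] box[OF L] by measurable
    have "(LINT \<mu>|Q. exp (- pairing \<mu> g) ^ i * G \<mu>) = (LINT \<mu>|R. exp (- pairing \<mu> g) ^ i * G \<mu>)" for i
    proof -
      \<comment> \<open>The \<open>i\<close>-th power of the exponential of \<open>g\<close> merges
        with that of \<open>f\<close>, so each moment is an instance of the induction hypothesis
        with exponent \<open>f + i * g\<close>.\<close>
      let ?h = "\<lambda>x. f x + real i * g x"
      have h: "?h \<in> compact_support_pos"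
        using f g by (auto simp: compact_support_pos_def intro!: compact_support_fun_add compact_support_fun_cmult)
      have "exp (- pairing \<mu> g) ^ i * G \<mu> = exp (- pairing \<mu> ?h) * indicator (lower_box \<rho> L) \<mu>"
        if "\<mu> \<in> state_set \<rho>" for \<mu>
      proof -
        have "pairing \<mu> ?h = pairing \<mu> f + real i * pairing \<mu> g"
          using that f g by (subst pairing_add)
            (auto simp: state_set_def pairing_cmult intro: compact_support_posD compact_support_fun_cmult)
        then show ?thesis
          by (simp add: G_def mult_exp_exp flip: mult.assoc exp_of_nat_mult)
      qed
      then have "(LINT \<mu>|P. exp (- pairing \<mu> g) ^ i * G \<mu>)
          = (LINT \<mu>|P. exp (- pairing \<mu> ?h) * indicator (lower_box \<rho> L) \<mu>)"
        if "space P = state_set \<rho>" for P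
        using that by (intro Bochner_Integration.integral_cong) auto
      then show ?thesis
        using Cons.IH[OF _ h] L sQ sR Cons by simp
    qed
    then have "(LINT \<mu>|Q. indicator {exp (- a)<..} (exp (- pairing \<mu> g)) * G \<mu>)
        = (LINT \<mu>|R. indicator {exp (- a)<..} (exp (- pairing \<mu> g)) * G \<mu>)"
    proof (rule moments_determine_half_line_integral[rotated -1])
      show "finite_measure Q" "finite_measure R" "sets Q = sets R"
        using Q(2) R(2) by (auto intro: Q.finite_measure_axioms R.finite_measure_axioms)
      show "(\<lambda>\<mu>. exp (- pairing \<mu> g)) \<in> borel_measurable Q" "G \<in> borel_measurable Q"
        using meas[OF g] G unfolding measurable_cong_sets[OF Q(2) refl] by auto
      fix \<mu> assume "\<mu> \<in> space Q"
      then show "exp (- pairing \<mu> g) \<in> {0..1}" "\<bar>G \<mu>\<bar> \<le> 1"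
        using le1[of \<mu> f] le1[of \<mu> g] f g by (auto simp: sQ G_def indicator_def)
    qed
    \<comment> \<open>Exceeding \<open>exp (- a)\<close> means \<open>pairing \<mu> g < a\<close>,
      so this indicator adds the head of the list to the box.\<close>
    moreover have "(LINT \<mu>|P. indicator {exp (- a)<..} (exp (- pairing \<mu> g)) * G \<mu>)
        = (LINT \<mu>|P. exp (- pairing \<mu> f) * indicator (lower_box \<rho> (i # L)) \<mu>)"
      if "space P = state_set \<rho>" for P
      using that by (intro Bochner_Integration.integral_cong)
        (auto simp: G_def i lower_box_def indicator_def)
    ultimately show ?case
      using sQ sR by simp
  qed
  have zero: "(\<lambda>_. 0) \<in> compact_support_pos"
    by (auto simp: compact_support_pos_def compact_support_fun_def)
  have emeq: "emeasure Q (lower_box \<rho> L) = emeasure R (lower_box \<rho> L)"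
    if "L \<in> lists (compact_support_pos \<times> UNIV)" for L
    using key[OF that zero] box[OF that] Q(2) R(2)
    by (simp add: pairing_def Q.emeasure_eq_measure R.emeasure_eq_measure)
  show ?thesis
  \<comment> \<open>The box of the empty list is the whole state set, so a constant sequence
    exhausts it with finite measure.\<close>
  proof (rule measure_eqI_generator_eq[where E="lower_box \<rho> ` lists (compact_support_pos \<times> UNIV)"
        and \<Omega>="state_set \<rho>" and A="\<lambda>_. lower_box \<rho> []"])
    show "Int_stable (lower_box \<rho> ` lists (compact_support_pos \<times> UNIV))"
    proof (rule Int_stableI_image)
      fix L L' :: "((real^3 \<Rightarrow> real) \<times> real) list"
      assume "L \<in> lists (compact_support_pos \<times> UNIV)" "L' \<in> lists (compact_support_pos \<times> UNIV)"
      moreover have "lower_box \<rho> L \<inter> lower_box \<rho> L' = lower_box \<rho> (L @ L')"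
        by (auto simp: lower_box_def)
      ultimately show "\<exists>K\<in>lists (compact_support_pos \<times> UNIV). lower_box \<rho> L \<inter> lower_box \<rho> L' = lower_box \<rho> K"
        by (intro bexI[of _ "L @ L'"]) auto
    qed
    show "range (\<lambda>_. lower_box \<rho> []) \<subseteq> lower_box \<rho> ` lists (compact_support_pos \<times> UNIV)"
      by auto
  qed (use emeq Q(2) R(2) in \<open>auto simp: lower_box_def sets_state_space_lower_box\<close>)
qed

subsection \<open>The scaling property\<close>

theorem proposition2:
  fixes \<eta> \<beta> \<rho> t k \<alpha> lam :: real
    and \<mu> :: "(real^3) measure"
    and P :: "(real^3) measure \<Rightarrow> 'w measure" and X :: "real \<Rightarrow> 'w \<Rightarrow> (real^3) measure"
    and P' :: "(real^3) measure \<Rightarrow> 'v measure" and X' :: "real \<Rightarrow> 'v \<Rightarrow> (real^3) measure"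
  assumes "\<eta> > 0" and "0 < \<beta>" and "\<beta> < 1" and "1 < \<rho>" and "\<rho> < 2"
    and "t > 0" and "k > 0" and "\<mu> \<in> state_set \<rho>"
    and "point_source_super_bm \<eta> \<beta> \<rho> (lam * \<alpha>) P X"
    and "point_source_super_bm \<eta> \<beta> \<rho> (k powr (1/2) * lam * \<alpha>) P' X'"
  shows "equal_in_law (state_space \<rho>)
    (P (scale_measure (ennreal (k powr (1/\<beta>))) (dilate (k powr (- 1/2)) \<mu>)))
    (\<lambda>\<omega>. scale_measure (ennreal (k powr (- 1/\<beta>))) (dilate (k powr (1/2)) (X (k * t) \<omega>)))
    (P' \<mu>) (X' t)"
proof -
  define c where "c = sqrt k"
  define a where "a = k powr (- 1/\<beta>)"
  define b where "b = k powr (1/\<beta>)"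
  define \<mu>' where "\<mu>' = scale_measure (ennreal b) (dilate (inverse c) \<mu>)"
  define T where "T \<nu> = scale_measure (ennreal a) (dilate c \<nu>)" for \<nu>
  have pos: "c > 0" "a > 0" "b > 0" "k * t > 0"
    using assms by (simp_all add: c_def a_def b_def)
  have c: "k powr (1/2) = c" "k powr (- 1/2) = inverse c"
    using assms by (simp_all add: c_def powr_minus flip: powr_half_sqrt)
  have \<mu>: "radon_measure \<mu>"
    using assms by (simp add: state_set_def)
  have \<mu>': "\<mu>' \<in> state_set \<rho>"
    unfolding \<mu>'_def using assms pos by (intro state_set_scale_dilate) auto
  note bm = assms(9)[unfolded point_source_super_bm_def] assms(10)[unfolded point_source_super_bm_def c(1)]
  have XY: "prob_space (P \<mu>')" "X (k * t) \<in> measurable (P \<mu>') (state_space \<rho>)"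
    "prob_space (P' \<mu>)" "X' t \<in> measurable (P' \<mu>) (state_space \<rho>)"
    using bm \<mu>' assms pos(4) unfolding markov_family_def by (auto simp: space_state_space)
  have TX: "(\<lambda>\<omega>. T (X (k * t) \<omega>)) \<in> measurable (P \<mu>') (state_space \<rho>)"
    unfolding T_def using measurable_compose[OF XY(2) measurable_scale_dilate[OF pos(1,2)]] .
  have "distr (P \<mu>') (state_space \<rho>) (\<lambda>\<omega>. T (X (k * t) \<omega>)) = distr (P' \<mu>) (state_space \<rho>) (X' t)"
    (is "?Q = ?R")
  proof (rule laplace_functional_unique)
    show prob: "prob_space ?Q" "prob_space ?R"
      using XY TX by (auto intro: prob_space.prob_space_distr)
    show sets: "sets ?Q = sets (state_space \<rho>)" "sets ?R = sets (state_space \<rho>)"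
      by simp_all
    fix f assume f: "f \<in> compact_support_pos"
    \<comment> \<open>Chosen so that \<open>pairing (T \<nu>) f = pairing \<nu> f'\<close> for
      states \<open>\<nu>\<close>; it is also the datum that \<open>mild_solution_scale\<close>
      turns into \<open>f\<close>.\<close>
    define f' where "f' x = a * f (x /\<^sub>R c)" for x
    have f': "f' \<in> compact_support_pos"
      unfolding f'_def[abs_def] using compact_support_pos_scale[OF f, of "inverse c" a] pos by auto
    have tf: "f \<in> test_fun \<rho>" "f' \<in> test_fun \<rho>"
      using f f' compact_support_pos_subset_test_fun[of \<rho>] assms by auto
    obtain v where v: "mild_solution \<eta> \<beta> \<rho> (lam * \<alpha>) f' v"
      and lv: "- ln (LINT \<omega>|P \<mu>'. exp (pairing (X (k * t) \<omega>) (\<lambda>x. - f' x))) = pairing \<mu>' (v (k * t))"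
      using bm(1) tf(2) \<mu>' pos(4) unfolding unique_mild_solution_def by blast
    obtain v' where v': "\<And>w. mild_solution \<eta> \<beta> \<rho> (c * lam * \<alpha>) f w \<Longrightarrow> \<forall>t>0. \<forall>x\<in>punctured. w t x = v' t x"
      and lv': "- ln (LINT \<omega>|P' \<mu>. exp (pairing (X' t \<omega>) (\<lambda>x. - f x))) = pairing \<mu> (v' t)"
      using bm(2) tf(1) assms(6,8) unfolding unique_mild_solution_def by blast
    have "mild_solution \<eta> \<beta> \<rho> (c * lam * \<alpha>) f (\<lambda>t x. b * v (k * t) (c *\<^sub>R x))"
      using mild_solution_scale[where \<eta>=\<eta> and \<rho>=\<rho> and k=k and \<alpha>="lam * \<alpha>" and \<phi>=f] v assms
      by (simp add: c_def b_def f'_def[abs_def] a_def mult.assoc)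
    \<comment> \<open>Uniqueness identifies the scaled solution with the one in the log-Laplace
      formula of \<open>X'\<close>. The agreement is off the origin, which is outside the space of
      \<open>\<mu>\<close>.\<close>
    from v'[OF this] have vv': "v' t x = b * v (k * t) (c *\<^sub>R x)" if "x \<in> punctured" for x
      using assms(6) that by simp
    have "v (k * t) \<in> test_fun \<rho>"
      using v pos(4) by (simp add: mild_solution_def)
    \<comment> \<open>The mass factor and dilation that define \<open>\<mu>'\<close> act on
      \<open>v\<close> exactly as the scaling of solutions does.\<close>
    then have "pairing \<mu>' (v (k * t)) = pairing \<mu> (\<lambda>x. b * v (k * t) (c *\<^sub>R x))"
      unfolding \<mu>'_def using pos radon_measure_sets[OF \<mu>]
      by (subst pairing_scale_dilate) (auto intro: test_fun_measurable)
    also have "\<dots> = pairing \<mu> (v' t)"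
      unfolding pairing_def using vv' radon_measure_space[OF \<mu>]
      by (intro Bochner_Integration.integral_cong) auto
    finally have "ln (LINT \<omega>|P \<mu>'. exp (pairing (X (k * t) \<omega>) (\<lambda>x. - f' x)))
        = ln (LINT \<omega>|P' \<mu>. exp (pairing (X' t \<omega>) (\<lambda>x. - f x)))"
      using lv lv' by simp
    moreover have "(LINT \<omega>|P \<mu>'. exp (pairing (X (k * t) \<omega>) (\<lambda>x. - f' x)))
        = (LINT \<nu>|?Q. exp (- pairing \<nu> f))"
    proof -
      have "pairing (X (k * t) \<omega>) (\<lambda>x. - f' x) = - pairing (T (X (k * t) \<omega>)) f" if "\<omega> \<in> space (P \<mu>')" for \<omega>
      proof -
        have "X (k * t) \<omega> \<in> state_set \<rho>"
          using measurable_space[OF XY(2) that] by (simp add: space_state_space)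
        then have "pairing (T (X (k * t) \<omega>)) f = pairing (X (k * t) \<omega>) f'"
          unfolding T_def f'_def[abs_def] using pos f
          by (intro pairing_scale_dilate)
            (auto simp: state_set_def radon_measure_sets intro: compact_support_fun_measurable compact_support_posD)
        then show ?thesis
          by (simp add: pairing_uminus)
      qed
      then have "(LINT \<omega>|P \<mu>'. exp (pairing (X (k * t) \<omega>) (\<lambda>x. - f' x)))
          = (LINT \<omega>|P \<mu>'. exp (- pairing (T (X (k * t) \<omega>)) f))"
        by (intro Bochner_Integration.integral_cong) auto
      also have "\<dots> = (LINT \<nu>|?Q. exp (- pairing \<nu> f))"
        using measurable_pairing[OF compact_support_posD[OF f], of \<rho>]
        by (intro integral_distr[OF TX, symmetric]) measurable
      finally show ?thesis .
    qed
    moreover have "(LINT \<omega>|P' \<mu>. exp (pairing (X' t \<omega>) (\<lambda>x. - f x))) = (LINT \<nu>|?R. exp (- pairing \<nu> f))"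
      unfolding pairing_uminus
      using measurable_pairing[OF compact_support_posD[OF f], of \<rho>]
      by (intro integral_distr[OF XY(4), symmetric]) measurable
    ultimately show "(LINT \<nu>|?Q. exp (- pairing \<nu> f)) = (LINT \<nu>|?R. exp (- pairing \<nu> f))"
      using integral_exp_pairing_pos[OF prob(1) sets(1) f] integral_exp_pairing_pos[OF prob(2) sets(2) f]
      by (simp add: ln_inj_iff)
  qed
  then show ?thesis
    unfolding equal_in_law_def c using TX XY(4) by (simp add: T_def \<mu>'_def a_def b_def)
qed

end
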